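(* Consider any discrete memoryless two-user multiple access channel with generalized feedback (MAC-GF) whose transition probability has the form $$p(y,y_{F_1},y_{F_2}|x_1,x_2)=p(y|x_1,x_2)\,p(y_{F_1}|x_2)\,p(y_{F_2}|x_1).$$ Its capacity region is contained in the region $\mathcal{DB}^{MAC}_{UC}$, defined as the set (union over all admissible distributions) of all pairs $(R_1,R_2)$ of nonnegative reals for which there exist random variables $(T,X_1,X_2,Y,Y_{F_1},Y_{F_2})$ with $$R_1\le I(X_1;Y,Y_{F_2}|X_2,T),\qquad R_2\le I(X_2;Y,Y_{F_1}|X_1,T),$$ $$R_1+R_2\le I(X_1,X_2;Y,Y_{F_1},Y_{F_2}|T),\qquad R_1+R_2\le I(X_1,X_2;Y),$$ whose joint distribution has the form $$p(t,x_1,x_2,y,y_{F_1},y_{F_2})=p(t,x_1,x_2)\,p(y|x_1,x_2)\,p(y_{F_1}|x_2)\,p(y_{F_2}|x_1),$$ and which satisfy the dependence balance bound $$I(X_1;X_2|T)\le I(X_1;X_2|Y_{F_1},Y_{F_2},T),$$ where the alphabet $\mathcal T$ of $T$ is subject to the cardinality constraint $|\mathcal T|\le|\mathcal X_1||\mathcal X_2|+3$.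
   Context: A discrete memoryless MAC-GF consists of finite input alphabets $\mathcal X_1,\mathcal X_2$, a finite receiver output alphabet $\mathcal Y$, finite feedback alphabets $\mathcal Y_{F_1},\mathcal Y_{F_2}$ (at transmitters 1 and 2), and a transition probability $p(y,y_{F_1},y_{F_2}|x_1,x_2)$, used memorylessly. An $(n,M_1,M_2,P_e)$ code consists of encoding functions $f_{ki}:\{1,\dots,M_k\}\times\mathcal Y_{F_k}^{i-1}\to\mathcal X_k$, $k=1,2$, $i=1,\dots,n$ (so $X_{ki}=f_{ki}(W_k,Y_{F_k}^{i-1})$), and a decoder $g:\mathcal Y^n\to\{1,\dots,M_1\}\times\{1,\dots,M_2\}$. The messages $W_1,W_2$ are independent and uniform on $\{1,\dots,M_1\}$, $\{1,\dots,M_2\}$, and $P_e=\Pr[(\hat W_1,\hat W_2)\ne(W_1,W_2)]$, where $(\hat W_1,\hat W_2)=g(Y^n)$. A pair $(R_1,R_2)$ of nonnegative reals is achievable if for every $\epsilon>0$ and all sufficiently large $n$ there is a code with $R_1\le \log(M_1)/n$, $R_2\le\log(M_2)/n$ and $P_e\le\epsilon$. The capacity region is the closure of the set of achievable pairs. *)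

theory Defs
  imports "HOL-Probability.Probability"
begin

text \<open>
  Alphabets are finite types. A channel maps an input pair \<open>(x1, x2)\<close> to the joint law of
  \<open>(y, y_F1, y_F2)\<close>. Logarithms are to an arbitrary base \<open>b > 1\<close>, used both for rates
  and for mutual information.
\<close>

type_synonym ('x1, 'x2, 'y, 'f1, 'f2) mac_gf = "'x1 \<Rightarrow> 'x2 \<Rightarrow> ('y \<times> 'f1 \<times> 'f2) pmf"

text \<open>
  The encoder of transmitter \<open>k\<close> takes the time \<open>i \<ge> 1\<close>, the message and the list of the
  \<open>i - 1\<close> feedback symbols seen so far, oldest first.
\<close>

type_synonym ('f, 'x) encoder = "nat \<Rightarrow> nat \<Rightarrow> 'f list \<Rightarrow> 'x"
type_synonym 'y decoder = "'y list \<Rightarrow> nat \<times> nat"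

primrec outputs ::
  "('x1, 'x2, 'y, 'f1, 'f2) mac_gf \<Rightarrow> ('f1, 'x1) encoder \<Rightarrow> ('f2, 'x2) encoder \<Rightarrow>
    nat \<Rightarrow> nat \<Rightarrow> nat \<Rightarrow> ('y \<times> 'f1 \<times> 'f2) list pmf" where
  "outputs W e1 e2 w1 w2 0 = return_pmf []"
| "outputs W e1 e2 w1 w2 (Suc i) =
    bind_pmf (outputs W e1 e2 w1 w2 i) (\<lambda>h.
      map_pmf (\<lambda>z. h @ [z])
        (W (e1 (Suc i) w1 (map (\<lambda>(y, u1, u2). u1) h))
           (e2 (Suc i) w2 (map (\<lambda>(y, u1, u2). u2) h))))"

text \<open>Joint law of the message pair and the channel outputs over a block of length \<open>n\<close>;
  meaningful for \<open>M1, M2 \<ge> 1\<close>.\<close>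

definition code_law ::
  "('x1, 'x2, 'y, 'f1, 'f2) mac_gf \<Rightarrow> nat \<Rightarrow> nat \<Rightarrow> nat \<Rightarrow>
    ('f1, 'x1) encoder \<Rightarrow> ('f2, 'x2) encoder \<Rightarrow>
    ((nat \<times> nat) \<times> ('y \<times> 'f1 \<times> 'f2) list) pmf" where
  "code_law W n M1 M2 e1 e2 =
    bind_pmf (pair_pmf (pmf_of_set {1..M1}) (pmf_of_set {1..M2})) (\<lambda>(w1, w2).
      map_pmf (\<lambda>h. ((w1, w2), h)) (outputs W e1 e2 w1 w2 n))"

definition error_prob ::
  "('x1, 'x2, 'y, 'f1, 'f2) mac_gf \<Rightarrow> nat \<Rightarrow> nat \<Rightarrow> nat \<Rightarrow>
    ('f1, 'x1) encoder \<Rightarrow> ('f2, 'x2) encoder \<Rightarrow> 'y decoder \<Rightarrow> real" where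
  "error_prob W n M1 M2 e1 e2 g =
    measure_pmf.prob (code_law W n M1 M2 e1 e2) {(w, h). g (map fst h) \<noteq> w}"

definition is_code ::
  "('x1, 'x2, 'y, 'f1, 'f2) mac_gf \<Rightarrow> nat \<Rightarrow> nat \<Rightarrow> nat \<Rightarrow> real \<Rightarrow>
    ('f1, 'x1) encoder \<Rightarrow> ('f2, 'x2) encoder \<Rightarrow> 'y decoder \<Rightarrow> bool" where
  "is_code W n M1 M2 Pe e1 e2 g \<longleftrightarrow>
    1 \<le> M1 \<and> 1 \<le> M2 \<and>
    (\<forall>ys. length ys = n \<longrightarrow> g ys \<in> {1..M1} \<times> {1..M2}) \<and>
    Pe = error_prob W n M1 M2 e1 e2 g"

definition achievable ::
  "real \<Rightarrow> ('x1, 'x2, 'y, 'f1, 'f2) mac_gf \<Rightarrow> real \<Rightarrow> real \<Rightarrow> bool" where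
  "achievable b W R1 R2 \<longleftrightarrow>
    0 \<le> R1 \<and> 0 \<le> R2 \<and>
    (\<forall>\<epsilon>>0. \<exists>N. \<forall>n\<ge>N. \<exists>M1 M2 Pe e1 e2 g.
      is_code W n M1 M2 Pe e1 e2 g \<and>
      R1 \<le> log b (real M1) / real n \<and> R2 \<le> log b (real M2) / real n \<and> Pe \<le> \<epsilon>)"

definition capacity_region ::
  "real \<Rightarrow> ('x1, 'x2, 'y, 'f1, 'f2) mac_gf \<Rightarrow> (real \<times> real) set" where
  "capacity_region b W = closure {(R1, R2). achievable b W R1 R2}"

definition mi :: "real \<Rightarrow> 'w pmf \<Rightarrow> ('w \<Rightarrow> 'a) \<Rightarrow> ('w \<Rightarrow> 'b) \<Rightarrow> real" where
  "mi b P X Y =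
    prob_space.mutual_information (measure_pmf P) b (count_space UNIV) (count_space UNIV) X Y"

definition cmi ::
  "real \<Rightarrow> 'w pmf \<Rightarrow> ('w \<Rightarrow> 'a) \<Rightarrow> ('w \<Rightarrow> 'b) \<Rightarrow> ('w \<Rightarrow> 'c) \<Rightarrow> real" where
  "cmi b P X Y Z =
    prob_space.conditional_mutual_information (measure_pmf P) b
      (count_space UNIV) (count_space UNIV) (count_space UNIV) X Y Z"

text \<open>
  The random variables \<open>(T, X1, X2, Y, Y_F1, Y_F2)\<close> are the coordinates of a joint law \<open>P\<close>.
  The alphabet of \<open>T\<close> is a finite set of naturals, without loss of generality since only its
  cardinality matters. \<open>Q\<close> is the factor \<open>p(t, x1, x2)\<close>; \<open>V\<close>, \<open>V1\<close>, \<open>V2\<close> are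
  \<open>p(y | x1, x2)\<close>, \<open>p(y_F1 | x2)\<close>, \<open>p(y_F2 | x1)\<close>.
\<close>

definition DB_region ::
  "real \<Rightarrow> ('x1::finite \<Rightarrow> 'x2::finite \<Rightarrow> 'y::finite pmf) \<Rightarrow>
    ('x2 \<Rightarrow> 'f1::finite pmf) \<Rightarrow> ('x1 \<Rightarrow> 'f2::finite pmf) \<Rightarrow> (real \<times> real) set" where
  "DB_region b V V1 V2 = {(R1, R2). 0 \<le> R1 \<and> 0 \<le> R2 \<and>
    (\<exists>(\<T> :: nat set) (Q :: (nat \<times> 'x1 \<times> 'x2) pmf)
       (P :: (nat \<times> 'x1 \<times> 'x2 \<times> 'y \<times> 'f1 \<times> 'f2) pmf).
      let T = (\<lambda>(t, x1, x2, y, u1, u2). t);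
          X1 = (\<lambda>(t, x1, x2, y, u1, u2). x1);
          X2 = (\<lambda>(t, x1, x2, y, u1, u2). x2);
          Y = (\<lambda>(t, x1, x2, y, u1, u2). y);
          YF1 = (\<lambda>(t, x1, x2, y, u1, u2). u1);
          YF2 = (\<lambda>(t, x1, x2, y, u1, u2). u2)
      in
        finite \<T> \<and> card \<T> \<le> CARD('x1) * CARD('x2) + 3 \<and>
        (\<forall>\<omega>\<in>set_pmf P. T \<omega> \<in> \<T>) \<and>
        (\<forall>t x1 x2 y u1 u2. pmf P (t, x1, x2, y, u1, u2) =
          pmf Q (t, x1, x2) * pmf (V x1 x2) y * pmf (V1 x2) u1 * pmf (V2 x1) u2) \<and>
        cmi b P X1 X2 T \<le> cmi b P X1 X2 (\<lambda>\<omega>. (YF1 \<omega>, YF2 \<omega>, T \<omega>)) \<and>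
        R1 \<le> cmi b P X1 (\<lambda>\<omega>. (Y \<omega>, YF2 \<omega>)) (\<lambda>\<omega>. (X2 \<omega>, T \<omega>)) \<and>
        R2 \<le> cmi b P X2 (\<lambda>\<omega>. (Y \<omega>, YF1 \<omega>)) (\<lambda>\<omega>. (X1 \<omega>, T \<omega>)) \<and>
        R1 + R2 \<le> cmi b P (\<lambda>\<omega>. (X1 \<omega>, X2 \<omega>)) (\<lambda>\<omega>. (Y \<omega>, YF1 \<omega>, YF2 \<omega>)) T \<and>
        R1 + R2 \<le> mi b P (\<lambda>\<omega>. (X1 \<omega>, X2 \<omega>)) Y)}"

end

theory Submission
  imports Defs "HOL-Complex_Analysis.Great_Picard"
begin

text \<open>
  Let \<open>F_i\<close> be the pair of feedback symbols at time \<open>i\<close> and \<open>T = (i, F_1, \<dots>, F_(i - 1))\<close> with \<open>i\<close> uniform.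
  Since \<open>X_k\<close> is a function of \<open>W_k\<close> and \<open>T\<close>, each of \<open>H(W1 | W2, Z)\<close>, \<open>H(W2 | W1, Z)\<close> and \<open>H(W1, W2 | Z)\<close>,
  where \<open>Z\<close> collects the outputs so far, drops in one channel use by at most the corresponding information
  given \<open>T\<close>; Fano's inequality makes the total drop almost \<open>log M1\<close>, \<open>log M2\<close> or \<open>log M1 + log M2\<close>.
  The form of the channel removes \<open>Y_F1\<close> from the first bound and \<open>Y_F2\<close> from the second.
  Likewise \<open>I(W1; W2 | F)\<close>, which starts at \<open>0\<close> and ends nonnegative, grows at each step by at most
  \<open>I(X1; X2 | Y_F1, Y_F2, T) - I(X1; X2 | T)\<close>; this is the dependence balance bound.
  All quantities given \<open>T\<close> are linear in the weights of the values of \<open>T\<close>. Keeping the law of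
  \<open>(X1, X2)\<close> and the first three informations fixed while maximising the balance gap is a linear program with
  \<open>|X1| |X2| + 3\<close> equations, and a basic optimal solution uses no more values of \<open>T\<close> than that.
  The remaining slack disappears by compactness, the alphabet of \<open>T\<close> being bounded.
\<close>

subsection \<open>Entropy of finite weights\<close>

text \<open>The bound R1 + R2 \<le> I(X1, X2; Y) is the only one not conditioned on T, and it shapes
  the proof twice. It is concave rather than linear in the law of (X1, X2), so the uses of a block
  are merged by superadditivity instead of being summed; and the linear program has to keep the
  whole law of (X1, X2), which costs |X1| |X2| equations and fixes the total mass as well. The three
  informations given T cost 3 more. Dependence balance is only an inequality, so it can serve as the
  objective instead of costing a further equation; this is where the constant comes from. T contains
  feedback but no past receiver outputs. For the three rates, passing from the whole past to T can
  only enlarge the bounding information. In the increment of I(W1; W2 | F) the subtracted entropy of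
  the new feedback given the past would change in the wrong direction, so that quantity is
  conditioned on feedback alone from the start. The reduction has to precede the limit, because the
  number of feedback histories grows with the block length.\<close>

definition marg :: "'a set \<Rightarrow> ('a \<Rightarrow> real) \<Rightarrow> ('a \<Rightarrow> 'b) \<Rightarrow> 'b \<Rightarrow> real" where
  "marg A m f v = (\<Sum>a\<in>{a \<in> A. f a = v}. m a)"

text \<open>Natural logarithms, and no normalisation of \<open>m\<close>. The pointwise form depends on \<open>f\<close> only through the
  partition it induces on \<open>A\<close>; a term with \<open>m a = 0\<close> vanishes.\<close>

definition ent :: "'a set \<Rightarrow> ('a \<Rightarrow> real) \<Rightarrow> ('a \<Rightarrow> 'b) \<Rightarrow> real" where
  "ent A m f = - (\<Sum>a\<in>A. m a * ln (marg A m f (f a)))"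

definition ci :: "'a set \<Rightarrow> ('a \<Rightarrow> real) \<Rightarrow> ('a \<Rightarrow> 'b) \<Rightarrow> ('a \<Rightarrow> 'c) \<Rightarrow> ('a \<Rightarrow> 'd) \<Rightarrow> real" where
  "ci A m X Y Z = ent A m (\<lambda>a. (X a, Z a)) + ent A m (\<lambda>a. (Y a, Z a))
     - ent A m Z - ent A m (\<lambda>a. (X a, Y a, Z a))"

lemma marg_nonneg: "(\<And>a. a \<in> A \<Longrightarrow> 0 \<le> m a) \<Longrightarrow> 0 \<le> marg A m f v"
  unfolding marg_def by (intro sum_nonneg) auto

lemma marg_ge:
  assumes "finite A" "\<And>a. a \<in> A \<Longrightarrow> 0 \<le> m a" "a \<in> A"
  shows "m a \<le> marg A m f (f a)"
  unfolding marg_def using assms by (intro member_le_sum) auto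

lemma marg_pos:
  assumes "finite A" "\<And>a. a \<in> A \<Longrightarrow> 0 \<le> m a" "a \<in> A" "0 < m a"
  shows "0 < marg A m f (f a)"
  using marg_ge[of A m a f] assms by (meson less_le_trans)

lemma marg_fun:
  assumes "finite A" "finite B" "\<pi> ` A \<subseteq> B"
  shows "marg A m (\<lambda>a. f (\<pi> a)) v = marg B (marg A m \<pi>) f v"
proof -
  have "(\<Sum>a\<in>{a \<in> A. f (\<pi> a) = v}. m a) =
      (\<Sum>b\<in>{b \<in> B. f b = v}. \<Sum>a\<in>{a \<in> {a \<in> A. f (\<pi> a) = v}. \<pi> a = b}. m a)"
    using assms by (intro sum.group[symmetric]) auto
  also have "\<dots> = (\<Sum>b\<in>{b \<in> B. f b = v}. \<Sum>a\<in>{a \<in> A. \<pi> a = b}. m a)"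
    by (intro sum.cong) auto
  finally show ?thesis by (simp add: marg_def)
qed

lemma sum_marg:
  assumes "finite A" "finite B" "f ` A \<subseteq> B"
  shows "(\<Sum>v\<in>B. marg A m f v * \<phi> v) = (\<Sum>a\<in>A. m a * \<phi> (f a))"
proof -
  have "(\<Sum>v\<in>B. marg A m f v * \<phi> v) = (\<Sum>v\<in>B. \<Sum>a\<in>{a \<in> A. f a = v}. m a * \<phi> (f a))"
    by (intro sum.cong) (auto simp: marg_def sum_distrib_right)
  also have "\<dots> = (\<Sum>a\<in>A. m a * \<phi> (f a))"
    using assms by (intro sum.group) auto
  finally show ?thesis .
qed

lemma sum_marg_eq:
  assumes "finite A" "finite B" "f ` A \<subseteq> B"
  shows "(\<Sum>v\<in>B. marg A m f v) = (\<Sum>a\<in>A. m a)"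
  using sum_marg[OF assms, of m "\<lambda>_. 1"] by simp

lemma ent_eq_sum_marg:
  assumes "finite A" "finite B" "f ` A \<subseteq> B"
  shows "ent A m f = - (\<Sum>v\<in>B. marg A m f v * ln (marg A m f v))"
  unfolding ent_def by (simp add: sum_marg[OF assms])

lemma ent_cong:
  assumes "\<And>a a'. a \<in> A \<Longrightarrow> a' \<in> A \<Longrightarrow> f a = f a' \<longleftrightarrow> g a = g a'"
  shows "ent A m f = ent A m g"
proof -
  have "marg A m f (f a) = marg A m g (g a)" if "a \<in> A" for a
    unfolding marg_def using assms that by (intro sum.cong) auto
  then show ?thesis unfolding ent_def by simp
qed

lemma ent_weight_cong:
  assumes "\<And>a. a \<in> A \<Longrightarrow> m a = m' a"
  shows "ent A m f = ent A m' f"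
  unfolding ent_def marg_def using assms by (auto intro!: sum.cong)

lemma ent_image:
  assumes "finite A" "finite B" "\<pi> ` A \<subseteq> B" "\<And>v. v \<in> B \<Longrightarrow> marg A m \<pi> v = m' v"
  shows "ent A m (\<lambda>a. f (\<pi> a)) = ent B m' f"
proof -
  have "ent A m (\<lambda>a. f (\<pi> a)) = - (\<Sum>a\<in>A. m a * ln (marg B (marg A m \<pi>) f (f (\<pi> a))))"
    by (simp add: ent_def marg_fun[OF assms(1-3)])
  also have "\<dots> = ent B (marg A m \<pi>) f"
    by (simp add: ent_def sum_marg[OF assms(1-3), of m "\<lambda>v. ln (marg B (marg A m \<pi>) f (f v))"])
  finally show ?thesis using ent_weight_cong[of B "marg A m \<pi>" m' f] assms(4) by simp
qed

text \<open>Slices are not renormalised, so the weight of \<open>t\<close> stays inside their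
  logarithms and no separate entropy of \<open>T\<close> appears.\<close>

lemma ent_slices:
  assumes "finite A" "finite B" "finite C" "\<pi> ` A \<subseteq> B" "T ` A \<subseteq> C"
  shows "ent A m (\<lambda>a. (f (\<pi> a), T a)) = (\<Sum>t\<in>C. ent B (\<lambda>v. marg A m (\<lambda>a. (\<pi> a, T a)) (v, t)) f)"
proof -
  let ?\<mu> = "marg A m (\<lambda>a. (\<pi> a, T a))"
  have sub: "(\<lambda>a. (\<pi> a, T a)) ` A \<subseteq> B \<times> C" using assms by auto
  have fin: "finite (B \<times> C)" using assms by simp
  have m: "marg (B \<times> C) ?\<mu> (\<lambda>(v, t). (f v, t)) (f v, t) = marg B (\<lambda>v. ?\<mu> (v, t)) f (f v)"
    if "t \<in> C" for v t
  proof -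
    have "{a \<in> B \<times> C. (\<lambda>(v, t). (f v, t)) a = (f v, t)} = (\<lambda>v. (v, t)) ` {a \<in> B. f a = f v}"
      using that by auto
    then show ?thesis
      unfolding marg_def by (simp add: sum.reindex inj_on_def)
  qed
  have "ent A m (\<lambda>a. (f (\<pi> a), T a)) = ent A m (\<lambda>a. (\<lambda>(v, t). (f v, t)) (\<pi> a, T a))"
    by simp
  also have "\<dots> = ent (B \<times> C) ?\<mu> (\<lambda>(v, t). (f v, t))"
    by (rule ent_image[OF assms(1) fin sub]) simp
  also have "\<dots> = - (\<Sum>v\<in>B. \<Sum>t\<in>C. ?\<mu> (v, t) * ln (marg (B \<times> C) ?\<mu> (\<lambda>(v, t). (f v, t)) (f v, t)))"
    unfolding ent_def by (simp add: sum.cartesian_product case_prod_beta)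
  also have "\<dots> = - (\<Sum>t\<in>C. \<Sum>v\<in>B. ?\<mu> (v, t) * ln (marg B (\<lambda>v. ?\<mu> (v, t)) f (f v)))"
    by (subst sum.swap) (simp add: m cong: sum.cong)
  finally show ?thesis by (simp add: ent_def sum_negf)
qed

text \<open>The correction depends on the total mass only, not on \<open>f\<close>, so it cancels in
  \<open>ci\<close>, where two entropies are added and two subtracted.\<close>

lemma ent_scale:
  assumes "finite A" "0 \<le> c" "\<And>a. a \<in> A \<Longrightarrow> 0 \<le> m a"
  shows "ent A (\<lambda>a. c * m a) f = c * ent A m f - c * ln c * (\<Sum>a\<in>A. m a)"
proof (cases "c = 0")
  case False
  have mg: "marg A (\<lambda>a. c * m a) f v = c * marg A m f v" for v
    by (simp add: marg_def sum_distrib_left)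
  have "c * m a * ln (c * marg A m f (f a)) = c * (m a * ln (marg A m f (f a))) + c * ln c * m a"
    if "a \<in> A" for a
  proof (cases "m a = 0")
    case False
    then have "0 < marg A m f (f a)" using assms that by (intro marg_pos) (auto simp: less_le)
    then show ?thesis using \<open>c \<noteq> 0\<close> assms(2) by (simp add: ln_mult algebra_simps)
  qed simp
  then show ?thesis
    by (simp add: ent_def mg sum.distrib sum_distrib_left[symmetric] cong: sum.cong)
qed (simp add: ent_def)

text \<open>Gibbs' inequality for conditional entropy: \<open>r\<close> is a conditional
  sub-distribution of \<open>f\<close> given \<open>g\<close>. It serves twice, with a true
  conditional law in \<open>ent_submodular\<close> and with a guess in
  \<open>ent_fano\<close>.\<close>

lemma ent_le_cross:
  assumes fin: "finite A" and m: "\<And>a. a \<in> A \<Longrightarrow> 0 \<le> m a"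
    and pos: "\<And>a. a \<in> A \<Longrightarrow> 0 < m a \<Longrightarrow> 0 < r (f a) (g a)"
    and nn: "\<And>a a'. a \<in> A \<Longrightarrow> a' \<in> A \<Longrightarrow> 0 \<le> r (f a) (g a')"
    and sub: "\<And>a. a \<in> A \<Longrightarrow> (\<Sum>u\<in>f ` A. r u (g a)) \<le> 1"
  shows "ent A m (\<lambda>a. (f a, g a)) - ent A m g \<le> - (\<Sum>a\<in>A. m a * ln (r (f a) (g a)))"
proof -
  let ?fg = "\<lambda>a. (f a, g a)"
  let ?\<mu> = "marg A m ?fg" and ?\<nu> = "marg A m g"
  \<comment> \<open>\<open>ln x \<le> x - 1\<close> at the ratio of r(f | g) p(g) to p(f, g), point
    by point.\<close>
  have le: "m a * (ln (r (f a) (g a)) + ln (?\<nu> (g a)) - ln (?\<mu> (f a, g a)))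
      \<le> m a * (r (f a) (g a) * ?\<nu> (g a) / ?\<mu> (f a, g a)) - m a" if a: "a \<in> A" for a
  proof (cases "m a = 0")
    case False
    then have p: "0 < m a" using m a by (auto simp: less_le)
    have q: "0 < ?\<nu> (g a)" "0 < ?\<mu> (f a, g a)" "0 < r (f a) (g a)"
      using marg_pos[of A m a g] marg_pos[of A m a ?fg] fin m pos a p by auto
    have "ln (r (f a) (g a)) + ln (?\<nu> (g a)) - ln (?\<mu> (f a, g a))
        = ln (r (f a) (g a) * ?\<nu> (g a) / ?\<mu> (f a, g a))"
      using q by (simp add: ln_mult ln_div)
    also have "\<dots> \<le> r (f a) (g a) * ?\<nu> (g a) / ?\<mu> (f a, g a) - 1"
      using q by (intro ln_le_minus_one) auto
    finally have "m a * (ln (r (f a) (g a)) + ln (?\<nu> (g a)) - ln (?\<mu> (f a, g a)))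
        \<le> m a * (r (f a) (g a) * ?\<nu> (g a) / ?\<mu> (f a, g a) - 1)"
      using p by (intro mult_left_mono) auto
    then show ?thesis by (simp only: right_diff_distrib mult_1_right)
  qed simp
  have "(\<Sum>a\<in>A. m a * (r (f a) (g a) * ?\<nu> (g a) / ?\<mu> (f a, g a)))
      = (\<Sum>(u, v)\<in>?fg ` A. ?\<mu> (u, v) * (r u v * ?\<nu> v / ?\<mu> (u, v)))"
    using sum_marg[OF fin, of "?fg ` A" ?fg m "\<lambda>(u, v). r u v * ?\<nu> v / ?\<mu> (u, v)"] fin
    by (simp add: case_prod_beta)
  also have "\<dots> \<le> (\<Sum>(u, v)\<in>?fg ` A. r u v * ?\<nu> v)"
    using nn marg_nonneg[of A m g] m by (intro sum_mono) auto
  \<comment> \<open>The attained pairs are extended to a full product so that \<open>sub\<close>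
    applies for each value of \<open>g\<close>.\<close>
  also have "\<dots> \<le> (\<Sum>(u, v)\<in>f ` A \<times> g ` A. r u v * ?\<nu> v)"
    using nn marg_nonneg[of A m g] m fin by (intro sum_mono2) auto
  also have "\<dots> = (\<Sum>v\<in>g ` A. (\<Sum>u\<in>f ` A. r u v) * ?\<nu> v)"
    by (subst sum.cartesian_product[symmetric], subst sum.swap) (simp add: sum_distrib_right)
  also have "\<dots> \<le> (\<Sum>v\<in>g ` A. ?\<nu> v)"
  proof (intro sum_mono)
    fix v assume "v \<in> g ` A"
    then have "(\<Sum>u\<in>f ` A. r u v) \<le> 1" using sub by auto
    then show "(\<Sum>u\<in>f ` A. r u v) * ?\<nu> v \<le> ?\<nu> v"
      using mult_right_mono[of "\<Sum>u\<in>f ` A. r u v" 1 "?\<nu> v"] marg_nonneg[of A m g v] m by simp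
  qed
  also have "\<dots> = (\<Sum>a\<in>A. m a)" using fin by (intro sum_marg_eq) auto
  finally have "(\<Sum>a\<in>A. m a * (r (f a) (g a) * ?\<nu> (g a) / ?\<mu> (f a, g a)) - m a) \<le> 0"
    by (simp add: sum_subtractf)
  moreover have "(\<Sum>a\<in>A. m a * (ln (r (f a) (g a)) + ln (?\<nu> (g a)) - ln (?\<mu> (f a, g a))))
      \<le> (\<Sum>a\<in>A. m a * (r (f a) (g a) * ?\<nu> (g a) / ?\<mu> (f a, g a)) - m a)"
    by (intro sum_mono le)
  ultimately have "(\<Sum>a\<in>A. m a * (ln (r (f a) (g a)) + ln (?\<nu> (g a)) - ln (?\<mu> (f a, g a)))) \<le> 0"
    by linarith
  then show ?thesis
    by (simp add: ent_def distrib_left right_diff_distrib sum.distrib sum_subtractf)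
qed

text \<open>The conditional law of \<open>f\<close> given \<open>h\<close> alone is one admissible
  guess at \<open>f\<close> from \<open>(g, h)\<close>, and its cross entropy is H(f | h). This is
  the inequality that conditioning reduces entropy.\<close>

lemma ent_submodular:
  assumes fin: "finite A" and m: "\<And>a. a \<in> A \<Longrightarrow> 0 \<le> m a"
  shows "ent A m (\<lambda>a. (f a, g a, h a)) - ent A m (\<lambda>a. (g a, h a))
    \<le> ent A m (\<lambda>a. (f a, h a)) - ent A m h"
proof -
  let ?\<mu> = "marg A m (\<lambda>a. (f a, h a))" and ?\<nu> = "marg A m h"
  define r where "r u v = ?\<mu> (u, snd v) / ?\<nu> (snd v)" for u and v :: "'c \<times> 'd"
  have p: "0 < ?\<mu> (f a, h a)" "0 < ?\<nu> (h a)" if "a \<in> A" "0 < m a" for a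
    using marg_pos[of A m a h] marg_pos[of A m a "\<lambda>a. (f a, h a)"] fin m that by auto
  have nn: "0 \<le> ?\<mu> v" "0 \<le> ?\<nu> w" for v w using m by (auto intro: marg_nonneg)
  have "ent A m (\<lambda>a. (f a, g a, h a)) - ent A m (\<lambda>a. (g a, h a))
      \<le> - (\<Sum>a\<in>A. m a * ln (r (f a) (g a, h a)))"
  proof (rule ent_le_cross[OF fin m])
    fix a assume a: "a \<in> A"
    have "(\<Sum>u\<in>f ` A. ?\<mu> (u, h a)) = ?\<nu> (h a)"
    proof -
      have "(\<Sum>u\<in>f ` A. ?\<mu> (u, h a)) = (\<Sum>u\<in>f ` A. \<Sum>a\<in>{x \<in> {x \<in> A. h x = h a}. f x = u}. m a)"
        unfolding marg_def by (intro sum.cong) auto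
      also have "\<dots> = (\<Sum>a\<in>{x \<in> A. h x = h a}. m a)"
        using fin by (intro sum.group) auto
      finally show ?thesis by (simp add: marg_def)
    qed
    then show "(\<Sum>u\<in>f ` A. r u (g a, h a)) \<le> 1"
      by (simp add: r_def sum_divide_distrib[symmetric])
  qed (use p nn in \<open>auto simp: r_def\<close>)
  also have "\<dots> = - (\<Sum>a\<in>A. m a * (ln (?\<mu> (f a, h a)) - ln (?\<nu> (h a))))"
  proof -
    have "m a * ln (r (f a) (g a, h a)) = m a * (ln (?\<mu> (f a, h a)) - ln (?\<nu> (h a)))"
      if "a \<in> A" for a
      using p[OF that] m[OF that] by (cases "m a = 0") (auto simp: r_def ln_div less_le)
    then show ?thesis by (intro arg_cong[where f=uminus] sum.cong) auto
  qed
  also have "\<dots> = ent A m (\<lambda>a. (f a, h a)) - ent A m h"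
    by (simp add: ent_def right_diff_distrib sum_subtractf)
  finally show ?thesis .
qed

text \<open>The cross distribution puts mass \<open>1/2\<close> on the guess and spreads \<open>1/2\<close> over all values.\<close>

lemma ent_fano:
  assumes fin: "finite A" and m: "\<And>a. a \<in> A \<Longrightarrow> 0 \<le> m a" and one: "(\<Sum>a\<in>A. m a) = 1"
    and M: "card (f ` A) \<le> M" "1 \<le> M"
    and err: "(\<Sum>a\<in>{a \<in> A. f a \<noteq> d (g a)}. m a) \<le> \<epsilon>"
  shows "ent A m (\<lambda>a. (f a, g a)) - ent A m g \<le> ln 2 + \<epsilon> * ln M"
proof -
  define r where "r u v = (if u = d v then 1 / 2 else 1 / (2 * real M))" for u v
  have "ent A m (\<lambda>a. (f a, g a)) - ent A m g \<le> - (\<Sum>a\<in>A. m a * ln (r (f a) (g a)))"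
  proof (rule ent_le_cross[OF fin m])
    fix a assume a: "a \<in> A"
    have "(\<Sum>u\<in>f ` A. r u (g a)) \<le> (\<Sum>u\<in>f ` A. (if u = d (g a) then 1/2 else 0) + 1 / (2 * real M))"
      by (intro sum_mono) (auto simp: r_def)
    also have "\<dots> \<le> 1 / 2 + real (card (f ` A)) / (2 * real M)"
      using fin by (simp add: sum.distrib)
    also have "\<dots> \<le> 1" using M by (simp add: divide_simps)
    finally show "(\<Sum>u\<in>f ` A. r u (g a)) \<le> 1" .
  qed (use M in \<open>auto simp: r_def\<close>)
  \<comment> \<open>Every point costs \<open>ln 2\<close>, and a wrong guess costs a further
    \<open>ln M\<close>.\<close>
  also have "- (\<Sum>a\<in>A. m a * ln (r (f a) (g a)))
      = (\<Sum>a\<in>A. m a * ln 2 + (if f a \<noteq> d (g a) then m a else 0) * ln M)"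
    unfolding sum_negf[symmetric] using M
    by (intro sum.cong) (auto simp: r_def ln_div ln_mult algebra_simps)
  also have "\<dots> = ln 2 + (\<Sum>a\<in>{a \<in> A. f a \<noteq> d (g a)}. m a) * ln M"
    using fin one by (simp add: sum.distrib sum_distrib_right[symmetric] sum.inter_filter)
  also have "\<dots> \<le> ln 2 + \<epsilon> * ln M"
    using err M by (simp add: mult_right_mono)
  finally show ?thesis .
qed

text \<open>The right-hand side does not depend on \<open>g\<close> when \<open>L (g s)\<close> is determined by the channel input. This replaces all
  Markov chain arguments: conditioning on messages and past or on the inputs gives the same entropy.\<close>

lemma ent_channel:
  fixes p :: "'s \<Rightarrow> real" and k :: "'s \<Rightarrow> 'z::finite \<Rightarrow> real"
  assumes fin: "finite S" and p: "\<And>s. s \<in> S \<Longrightarrow> 0 \<le> p s" and k: "\<And>s z. 0 \<le> k s z"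
    and one: "\<And>s. (\<Sum>z\<in>UNIV. k s z) = 1"
    and L: "\<And>s z. s \<in> S \<Longrightarrow> (\<Sum>z'\<in>{z'. \<phi> z' = \<phi> z}. k s z') = L (g s) (\<phi> z)"
  shows "ent (S \<times> UNIV) (\<lambda>(s, z). p s * k s z) (\<lambda>(s, z). (g s, \<phi> z))
    - ent (S \<times> UNIV) (\<lambda>(s, z). p s * k s z) (\<lambda>(s, z). g s)
    = - (\<Sum>s\<in>S. p s * (\<Sum>z\<in>UNIV. k s z * ln (L (g s) (\<phi> z))))"
proof -
  let ?A = "S \<times> (UNIV :: 'z set)" and ?m = "\<lambda>(s, z). p s * k s z"
  have finA: "finite ?A" using fin by simp
  have m: "0 \<le> ?m a" if "a \<in> ?A" for a using p k that by auto
  have mg: "marg ?A ?m (\<lambda>(s, z). g s) v = marg S p g v" for v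
  proof -
    have "{a \<in> ?A. (case a of (s, z) \<Rightarrow> g s) = v} = {s \<in> S. g s = v} \<times> UNIV" by auto
    then have "marg ?A ?m (\<lambda>(s, z). g s) v = (\<Sum>s\<in>{s \<in> S. g s = v}. \<Sum>z\<in>UNIV. p s * k s z)"
      unfolding marg_def by (simp add: sum.cartesian_product)
    then show ?thesis by (simp add: marg_def sum_distrib_left[symmetric] one)
  qed
  have mgp: "marg ?A ?m (\<lambda>(s, z). (g s, \<phi> z)) (v, \<phi> z) = marg S p g v * L v (\<phi> z)" for v z
  proof -
    have "{a \<in> ?A. (case a of (s, z) \<Rightarrow> (g s, \<phi> z)) = (v, \<phi> z)} = {s \<in> S. g s = v} \<times> {z'. \<phi> z' = \<phi> z}"
      by auto
    then have "marg ?A ?m (\<lambda>(s, z). (g s, \<phi> z)) (v, \<phi> z)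
        = (\<Sum>s\<in>{s \<in> S. g s = v}. \<Sum>z'\<in>{z'. \<phi> z' = \<phi> z}. p s * k s z')"
      unfolding marg_def by (simp add: sum.cartesian_product)
    also have "\<dots> = (\<Sum>s\<in>{s \<in> S. g s = v}. p s * L v (\<phi> z))"
      using L by (intro sum.cong) (auto simp: sum_distrib_left[symmetric])
    finally show ?thesis by (simp add: marg_def sum_distrib_right)
  qed
  \<comment> \<open>The chain rule at one point: the marginal of \<open>(g, \<phi>)\<close> is that
    of \<open>g\<close> times \<open>L\<close>. Points of weight 0 are treated apart because
    \<open>ln\<close> splits products of positive factors.\<close>
  have eq: "p s * k s z * ln (marg ?A ?m (\<lambda>(s, z). (g s, \<phi> z)) (g s, \<phi> z))
      = p s * k s z * ln (marg ?A ?m (\<lambda>(s, z). g s) (g s)) + p s * (k s z * ln (L (g s) (\<phi> z)))"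
    if s: "s \<in> S" for s z
  proof (cases "p s * k s z = 0")
    case False
    then have "0 < p s" "0 < k s z" using p[OF s] k[of s z] by (auto simp: less_le)
    moreover have "k s z \<le> L (g s) (\<phi> z)"
      unfolding L[OF s, symmetric] using k by (intro member_le_sum) auto
    ultimately have "0 < marg S p g (g s)" "0 < L (g s) (\<phi> z)"
      using marg_pos[of S p s g] fin p s by auto
    then show ?thesis by (simp add: mg mgp ln_mult algebra_simps)
  qed auto
  have "(\<Sum>(s, z)\<in>?A. p s * k s z * ln (marg ?A ?m (\<lambda>(s, z). (g s, \<phi> z)) (g s, \<phi> z)))
      = (\<Sum>(s, z)\<in>?A. p s * k s z * ln (marg ?A ?m (\<lambda>(s, z). g s) (g s)))
        + (\<Sum>(s, z)\<in>?A. p s * (k s z * ln (L (g s) (\<phi> z))))"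
    unfolding sum.distrib[symmetric] by (intro sum.cong) (auto simp: eq)
  then show ?thesis
    by (simp add: ent_def sum_distrib_left sum.cartesian_product case_prod_unfold)
qed

subsection \<open>Mutual information of probability mass functions\<close>

lemma pmf_map_marg:
  assumes "finite A" "set_pmf P \<subseteq> A"
  shows "pmf (map_pmf X P) v = marg A (pmf P) X v"
proof -
  have "pmf (map_pmf X P) v = measure (measure_pmf P) (X -` {v} \<inter> set_pmf P)"
    by (simp add: pmf_map measure_Int_set_pmf)
  also have "\<dots> = sum (pmf P) (X -` {v} \<inter> set_pmf P)"
    using assms finite_subset by (intro measure_measure_pmf_finite) auto
  also have "\<dots> = sum (pmf P) {a \<in> A. X a = v}"
    using assms by (intro sum.mono_neutral_left) (auto simp: set_pmf_eq)
  finally show ?thesis by (simp add: marg_def)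
qed

lemma distributed_count_space_pmf:
  "distributed (measure_pmf P) (count_space UNIV) X (\<lambda>v. ennreal (pmf (map_pmf X P) v))"
  unfolding distributed_def measure_pmf_eq_density[symmetric] map_pmf_rep_eq by simp

lemma pair_measure_count_space_UNIV:
  "count_space (UNIV :: 'a::countable set) \<Otimes>\<^sub>M count_space (UNIV :: 'b::countable set) = count_space UNIV"
  by (simp add: pair_measure_countable)

text \<open>Countable value types turn the product of counting measures into a counting measure, and
  \<open>A\<close> carries \<open>P\<close>, so the defining integral is a finite sum. The factor
  \<open>1 / ln b\<close> accounts for the base.\<close>

lemma mi_eq_ent:
  fixes X :: "'w \<Rightarrow> 'a::countable" and Y :: "'w \<Rightarrow> 'b::countable"
  assumes b: "1 < b" and A: "finite A" "set_pmf P \<subseteq> A"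
  shows "mi b P X Y = (ent A (pmf P) X + ent A (pmf P) Y - ent A (pmf P) (\<lambda>w. (X w, Y w))) / ln b"
proof -
  interpret information_space "measure_pmf P" b by unfold_locales (rule b)
  let ?XY = "\<lambda>w. (X w, Y w)" and ?M = "marg A (pmf P)"
  define \<phi> where "\<phi> = (\<lambda>(x, y). log b (?M ?XY (x, y) / (?M X x * ?M Y y)))"
  have mp: "pmf (map_pmf Z P) v = ?M Z v" for Z :: "'w \<Rightarrow> 'z" and v
    by (rule pmf_map_marg[OF A])
  have XY: "distributed P (count_space UNIV \<Otimes>\<^sub>M count_space UNIV) ?XY
      (\<lambda>v. ennreal (pmf (map_pmf ?XY P) v))"
    unfolding pair_measure_count_space_UNIV by (rule distributed_count_space_pmf)
  have "mi b P X Y = (\<integral>v. pmf (map_pmf ?XY P) v * log b (pmf (map_pmf ?XY P) v /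
      (pmf (map_pmf X P) (fst v) * pmf (map_pmf Y P) (snd v))) \<partial>(count_space UNIV \<Otimes>\<^sub>M count_space UNIV))"
    unfolding mi_def
    by (rule mutual_information_distr[OF sigma_finite_measure_count_space sigma_finite_measure_count_space
          distributed_count_space_pmf _ distributed_count_space_pmf _ XY]) auto
  also have "\<dots> = (\<integral>v. ?M ?XY v * \<phi> v \<partial>count_space UNIV)"
    unfolding pair_measure_count_space_UNIV mp \<phi>_def by (simp add: case_prod_beta)
  also have "\<dots> = (\<Sum>v\<in>?XY ` A. ?M ?XY v * \<phi> v)"
  proof -
    have z: "?M ?XY v = 0" if "v \<notin> ?XY ` A" for v
      unfolding marg_def using that by (intro sum.neutral) auto
    then have sub: "{v. ?M ?XY v * \<phi> v \<noteq> 0} \<subseteq> ?XY ` A" by (metis (mono_tags, lifting) mem_Collect_eq mult_zero_left subsetI)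
    have "(\<integral>v. ?M ?XY v * \<phi> v \<partial>count_space UNIV) = (\<Sum>v | v \<in> UNIV \<and> ?M ?XY v * \<phi> v \<noteq> 0. ?M ?XY v * \<phi> v)"
      using finite_subset[OF sub] A by (intro lebesgue_integral_count_space_finite_support) auto
    also have "\<dots> = (\<Sum>v\<in>?XY ` A. ?M ?XY v * \<phi> v)"
      using sub A by (intro sum.mono_neutral_left) auto
    finally show ?thesis .
  qed
  also have "\<dots> = (\<Sum>a\<in>A. pmf P a * \<phi> (?XY a))"
    using A by (intro sum_marg) auto
  also have "\<dots> = (\<Sum>a\<in>A. (pmf P a * ln (?M ?XY (?XY a)) - pmf P a * ln (?M X (X a)) - pmf P a * ln (?M Y (Y a))) / ln b)"
  proof (intro sum.cong refl)
    fix a assume a: "a \<in> A"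
    show "pmf P a * \<phi> (?XY a) = (pmf P a * ln (?M ?XY (?XY a)) - pmf P a * ln (?M X (X a)) - pmf P a * ln (?M Y (Y a))) / ln b"
    proof (cases "pmf P a = 0")
      case False
      then have p: "0 < pmf P a" by (simp add: less_le)
      have "0 < ?M ?XY (?XY a)" "0 < ?M X (X a)" "0 < ?M Y (Y a)"
        using marg_pos[of A "pmf P" a ?XY] marg_pos[of A "pmf P" a X] marg_pos[of A "pmf P" a Y] A a p
        by auto
      then have "\<phi> (?XY a) = (ln (?M ?XY (?XY a)) - ln (?M X (X a)) - ln (?M Y (Y a))) / ln b"
        by (simp add: \<phi>_def log_def ln_div ln_mult)
      then show ?thesis by (simp add: right_diff_distrib)
    qed simp
  qed
  finally show ?thesis
    by (simp add: ent_def sum_divide_distrib[symmetric] sum_subtractf)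
qed

text \<open>Conditional mutual information is defined as I(X; (Y, Z)) - I(X; Z), in which the
  entropy of \<open>X\<close> cancels.\<close>

lemma cmi_eq_ci:
  fixes X :: "'w \<Rightarrow> 'a::countable" and Y :: "'w \<Rightarrow> 'b::countable" and Z :: "'w \<Rightarrow> 'c::countable"
  assumes "1 < b" "finite A" "set_pmf P \<subseteq> A"
  shows "cmi b P X Y Z = ci A (pmf P) X Y Z / ln b"
proof -
  have "cmi b P X Y Z = mi b P X (\<lambda>w. (Y w, Z w)) - mi b P X Z"
    unfolding cmi_def mi_def prob_space.conditional_mutual_information_def[OF measure_pmf.prob_space_axioms]
      pair_measure_count_space_UNIV ..
  then show ?thesis
    by (simp add: mi_eq_ent[OF assms] ci_def diff_divide_distrib[symmetric] algebra_simps)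
qed

subsection \<open>Single-letter functionals\<close>

text \<open>A form of \<open>ent_channel\<close> with \<open>L\<close> given per state;
  \<open>inv_into\<close> picks a representative for each value of \<open>g\<close>.\<close>

lemma ent_channel_determined:
  fixes p :: "'s \<Rightarrow> real" and k :: "'s \<Rightarrow> 'z::finite \<Rightarrow> real"
  assumes fin: "finite S" and p: "\<And>s. s \<in> S \<Longrightarrow> 0 \<le> p s" and k: "\<And>s z. 0 \<le> k s z"
    and one: "\<And>s. (\<Sum>z\<in>UNIV. k s z) = 1"
    and L: "\<And>s s' z. s \<in> S \<Longrightarrow> s' \<in> S \<Longrightarrow> g s = g s' \<Longrightarrow> L s (\<phi> z) = L s' (\<phi> z)"
    and m: "\<And>s z. s \<in> S \<Longrightarrow> (\<Sum>z'\<in>{z'. \<phi> z' = \<phi> z}. k s z') = L s (\<phi> z)"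
  shows "ent (S \<times> UNIV) (\<lambda>(s, z). p s * k s z) (\<lambda>(s, z). (g s, \<phi> z))
    - ent (S \<times> UNIV) (\<lambda>(s, z). p s * k s z) (\<lambda>(s, z). g s)
    = - (\<Sum>s\<in>S. p s * (\<Sum>z\<in>UNIV. k s z * ln (L s (\<phi> z))))"
proof -
  have i: "L (inv_into S g (g s)) (\<phi> z) = L s (\<phi> z)" if "s \<in> S" for s z
    using that by (intro L) (auto simp: inv_into_into f_inv_into_f)
  show ?thesis
    using ent_channel[of S p k \<phi> "\<lambda>v. L (inv_into S g v)" g] fin p k one m
    by (simp add: i cong: sum.cong)
qed

locale separable_mac =
  fixes V :: "'x1::finite \<Rightarrow> 'x2::finite \<Rightarrow> 'y::finite pmf"
    and V1 :: "'x2 \<Rightarrow> 'f1::finite pmf"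
    and V2 :: "'x1 \<Rightarrow> 'f2::finite pmf"
begin

fun chan :: "'x1 \<times> 'x2 \<Rightarrow> 'y \<times> 'f1 \<times> 'f2 \<Rightarrow> real" where
  "chan (x1, x2) (y, u1, u2) = pmf (V x1 x2) y * pmf (V1 x2) u1 * pmf (V2 x1) u2"

text \<open>Hidden outputs become \<open>None\<close>, so all subsets of the outputs share one type
  and \<open>ent_output\<close> covers them with three flags.\<close>

fun sel :: "bool \<Rightarrow> bool \<Rightarrow> bool \<Rightarrow> 'y \<times> 'f1 \<times> 'f2 \<Rightarrow> 'y option \<times> 'f1 option \<times> 'f2 option" where
  "sel c c1 c2 (y, u1, u2) =
    (if c then Some y else None, if c1 then Some u1 else None, if c2 then Some u2 else None)"

lemma chan_nonneg: "0 \<le> chan x z"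
  by (cases x; cases z) simp

lemma sum_chan_box:
  "(\<Sum>z\<in>A \<times> B \<times> C. chan (x1, x2) z) = sum (pmf (V x1 x2)) A * sum (pmf (V1 x2)) B * sum (pmf (V2 x1)) C"
proof -
  have "(\<Sum>z\<in>A \<times> B \<times> C. chan (x1, x2) z)
      = (\<Sum>y\<in>A. \<Sum>u1\<in>B. \<Sum>u2\<in>C. pmf (V x1 x2) y * pmf (V1 x2) u1 * pmf (V2 x1) u2)"
    by (subst sum.cartesian_product, subst sum.cartesian_product) (auto intro!: sum.cong)
  then show ?thesis
    by (simp add: sum_distrib_left[symmetric] sum_distrib_right[symmetric])
qed

lemma sum_chan: "(\<Sum>z\<in>UNIV. chan x z) = 1"
  using sum_chan_box[where A = UNIV and B = UNIV and C = UNIV] by (cases x) (simp add: sum_pmf_eq_1)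

lemma sum_chan_sel:
  "(\<Sum>z'\<in>{z'. sel c c1 c2 z' = sel c c1 c2 (y, u1, u2)}. chan (x1, x2) z') =
    (if c then pmf (V x1 x2) y else 1) * (if c1 then pmf (V1 x2) u1 else 1)
      * (if c2 then pmf (V2 x1) u2 else 1)"
proof -
  have "{z'. sel c c1 c2 z' = sel c c1 c2 (y, u1, u2)} =
      (if c then {y} else UNIV) \<times> (if c1 then {u1} else UNIV) \<times> (if c2 then {u2} else UNIV)"
    by auto
  then show ?thesis
    by (simp add: sum_chan_box sum_pmf_eq_1)
qed

definition joint :: "('s \<Rightarrow> real) \<Rightarrow> ('s \<Rightarrow> 'x1 \<times> 'x2) \<Rightarrow> 's \<times> 'y \<times> 'f1 \<times> 'f2 \<Rightarrow> real" where
  "joint p x = (\<lambda>(s, z). p s * chan (x s) z)"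

text \<open>For \<open>p\<close> of mass 1, \<open>noise\<close>, \<open>noise1\<close> and
  \<open>noise2\<close> are H(Y | X1, X2), H(Y_F1 | X2) and H(Y_F2 | X1).\<close>

definition noise :: "'s set \<Rightarrow> ('s \<Rightarrow> real) \<Rightarrow> ('s \<Rightarrow> 'x1 \<times> 'x2) \<Rightarrow> real" where
  "noise S p x = - (\<Sum>s\<in>S. p s * (\<Sum>z\<in>UNIV. chan (x s) z * ln (pmf (V (fst (x s)) (snd (x s))) (fst z))))"

definition noise1 :: "'s set \<Rightarrow> ('s \<Rightarrow> real) \<Rightarrow> ('s \<Rightarrow> 'x1 \<times> 'x2) \<Rightarrow> real" where
  "noise1 S p x = - (\<Sum>s\<in>S. p s * (\<Sum>z\<in>UNIV. chan (x s) z * ln (pmf (V1 (snd (x s))) (fst (snd z)))))"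

definition noise2 :: "'s set \<Rightarrow> ('s \<Rightarrow> real) \<Rightarrow> ('s \<Rightarrow> 'x1 \<times> 'x2) \<Rightarrow> real" where
  "noise2 S p x = - (\<Sum>s\<in>S. p s * (\<Sum>z\<in>UNIV. chan (x s) z * ln (pmf (V2 (fst (x s))) (snd (snd z)))))"

text \<open>Given the inputs the three outputs are independent, so their entropies add; each output
  only needs \<open>g\<close> to determine the part of the input on which it depends.\<close>

lemma ent_output:
  assumes fin: "finite S" and p: "\<And>s. s \<in> S \<Longrightarrow> 0 \<le> p s"
    and g: "\<And>s s'. s \<in> S \<Longrightarrow> s' \<in> S \<Longrightarrow> g s = g s' \<Longrightarrow>
      (c \<longrightarrow> x s = x s') \<and> (c1 \<longrightarrow> snd (x s) = snd (x s')) \<and> (c2 \<longrightarrow> fst (x s) = fst (x s'))"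
  shows "ent (S \<times> UNIV) (joint p x) (\<lambda>(s, z). (g s, sel c c1 c2 z)) =
    ent (S \<times> UNIV) (joint p x) (\<lambda>(s, z). g s)
      + of_bool c * noise S p x + of_bool c1 * noise1 S p x + of_bool c2 * noise2 S p x"
proof -
  define L where "L s u = (if c then pmf (V (fst (x s)) (snd (x s))) (the (fst u)) else 1)
      * (if c1 then pmf (V1 (snd (x s))) (the (fst (snd u))) else 1)
      * (if c2 then pmf (V2 (fst (x s))) (the (snd (snd u))) else 1)"
    for s and u :: "'y option \<times> 'f1 option \<times> 'f2 option"
  have "ent (S \<times> UNIV) (joint p x) (\<lambda>(s, z). (g s, sel c c1 c2 z))
      - ent (S \<times> UNIV) (joint p x) (\<lambda>(s, z). g s)
      = - (\<Sum>s\<in>S. p s * (\<Sum>z\<in>UNIV. chan (x s) z * ln (L s (sel c c1 c2 z))))"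
    unfolding joint_def
  proof (rule ent_channel_determined[OF fin p chan_nonneg sum_chan])
    show "L s (sel c c1 c2 z) = L s' (sel c c1 c2 z)" if "s \<in> S" "s' \<in> S" "g s = g s'" for s s' z
      using g[OF that] by (simp add: L_def)
    show "(\<Sum>z'\<in>{z'. sel c c1 c2 z' = sel c c1 c2 z}. chan (x s) z') = L s (sel c c1 c2 z)" for s z
    proof (cases "x s"; cases z)
      fix x1 x2 y w assume x: "x s = (x1, x2)" and z: "z = (y, w)"
      obtain u1 u2 where w: "w = (u1, u2)" by (cases w)
      show ?thesis
        unfolding x z w sum_chan_sel by (simp add: L_def x)
    qed
  qed
  moreover have "chan (x s) z * ln (L s (sel c c1 c2 z)) =
      of_bool c * (chan (x s) z * ln (pmf (V (fst (x s)) (snd (x s))) (fst z)))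
      + of_bool c1 * (chan (x s) z * ln (pmf (V1 (snd (x s))) (fst (snd z))))
      + of_bool c2 * (chan (x s) z * ln (pmf (V2 (fst (x s))) (snd (snd z))))" for s z
  proof (cases "chan (x s) z = 0")
    case False
    then have "0 < pmf (V (fst (x s)) (snd (x s))) (fst z)" "0 < pmf (V1 (snd (x s))) (fst (snd z))"
        "0 < pmf (V2 (fst (x s))) (snd (snd z))"
      by (cases "x s"; cases z; simp add: pmf_pos less_le)+
    then show ?thesis by (cases z) (simp add: L_def ln_mult algebra_simps)
  qed simp
  ultimately show ?thesis
    by (simp add: noise_def noise1_def noise2_def sum.distrib distrib_left sum_distrib_left
        mult.left_commute[of "p _" "of_bool _"])
qed

lemma ent_joint_fst:
  assumes fin: "finite S"
  shows "ent (S \<times> UNIV) (joint p x) (\<lambda>(s, z). g s) = ent S p g"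
proof -
  have m: "marg (S \<times> UNIV) (joint p x) fst s = p s" if "s \<in> S" for s
  proof -
    have "{a \<in> S \<times> UNIV. fst a = s} = {s} \<times> (UNIV :: ('y \<times> 'f1 \<times> 'f2) set)" using that by auto
    then show ?thesis
      unfolding marg_def joint_def
      by (simp add: sum.cartesian_product[symmetric] sum_distrib_left[symmetric] sum_chan)
  qed
  show ?thesis
    using ent_image[of "S \<times> UNIV" S fst "joint p x" p g] fin m by (simp add: case_prod_unfold)
qed

lemma joint_nonneg: "(\<And>s. s \<in> S \<Longrightarrow> 0 \<le> p s) \<Longrightarrow> a \<in> S \<times> UNIV \<Longrightarrow> 0 \<le> joint p x a"
  by (auto simp: joint_def chan_nonneg)

text \<open>Fixing \<open>C\<close> leaves the channel unchanged: the weights of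
  \<open>(x s, z)\<close> in a slice are the input weights of the slice followed by
  \<open>chan\<close>. So the informations of a slice depend on its input weights only.\<close>

lemma ent_slices_joint:
  fixes x :: "'s \<Rightarrow> 'x1 \<times> 'x2"
  assumes fin: "finite S" "finite D" "C ` S \<subseteq> D"
  shows "ent (S \<times> UNIV) (joint p x) (\<lambda>(s, z). (f (x s, z), C s))
    = (\<Sum>t\<in>D. ent UNIV (joint (\<lambda>v. marg S p (\<lambda>s. (x s, C s)) (v, t)) id) f)"
proof -
  have m: "marg (S \<times> UNIV) (joint p x) (\<lambda>a. ((x (fst a), snd a), C (fst a))) ((v, z), t)
      = joint (\<lambda>v. marg S p (\<lambda>s. (x s, C s)) (v, t)) id (v, z)" for v z t
  proof -
    have "{a \<in> S \<times> UNIV. ((x (fst a), snd a), C (fst a)) = ((v, z), t)}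
        = {s \<in> S. (x s, C s) = (v, t)} \<times> {z}" by auto
    then have "marg (S \<times> UNIV) (joint p x) (\<lambda>a. ((x (fst a), snd a), C (fst a))) ((v, z), t)
        = (\<Sum>s\<in>{s \<in> S. (x s, C s) = (v, t)}. p s * chan (x s) z)"
      unfolding marg_def joint_def by (simp add: sum.cartesian_product[symmetric])
    also have "\<dots> = (\<Sum>s\<in>{s \<in> S. (x s, C s) = (v, t)}. p s * chan v z)"
      by (intro sum.cong) auto
    finally show ?thesis by (simp add: marg_def joint_def sum_distrib_right)
  qed
  have "(\<lambda>w. marg (S \<times> UNIV) (joint p x) (\<lambda>a. ((x (fst a), snd a), C (fst a))) (w, t))
      = joint (\<lambda>v. marg S p (\<lambda>s. (x s, C s)) (v, t)) id" for t
    by (auto simp: fun_eq_iff m)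
  then show ?thesis
    using ent_slices[of "S \<times> UNIV" UNIV D "\<lambda>a. (x (fst a), snd a)" "\<lambda>a. C (fst a)" "joint p x" f] fin
    by (simp add: case_prod_unfold image_subset_iff)
qed

lemma ci_slices:
  fixes x :: "'s \<Rightarrow> 'x1 \<times> 'x2"
  assumes fin: "finite S" "finite D" "C ` S \<subseteq> D"
  shows "ci (S \<times> UNIV) (joint p x) (\<lambda>(s, z). f (x s, z)) (\<lambda>(s, z). g (x s, z)) (\<lambda>(s, z). (h (x s, z), C s))
    = (\<Sum>t\<in>D. ci UNIV (joint (\<lambda>v. marg S p (\<lambda>s. (x s, C s)) (v, t)) id) f g h)"
proof -
  have a: "ent (S \<times> UNIV) (joint p x) (\<lambda>a. (case a of (s, z) \<Rightarrow> u (x s, z), case a of (s, z) \<Rightarrow> (h (x s, z), C s)))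
    = (\<Sum>t\<in>D. ent UNIV (joint (\<lambda>v. marg S p (\<lambda>s. (x s, C s)) (v, t)) id) (\<lambda>a. (u a, h a)))"
    for u :: "_ \<Rightarrow> 'u"
    unfolding ent_slices_joint[OF fin, symmetric] by (intro ent_cong) auto
  have b: "ent (S \<times> UNIV) (joint p x) (\<lambda>a. (case a of (s, z) \<Rightarrow> f (x s, z), case a of (s, z) \<Rightarrow> g (x s, z),
      case a of (s, z) \<Rightarrow> (h (x s, z), C s)))
    = (\<Sum>t\<in>D. ent UNIV (joint (\<lambda>v. marg S p (\<lambda>s. (x s, C s)) (v, t)) id) (\<lambda>a. (f a, g a, h a)))"
    unfolding ent_slices_joint[OF fin, symmetric] by (intro ent_cong) auto
  show ?thesis
    unfolding ci_def a b ent_slices_joint[OF fin] by (simp add: sum.distrib sum_subtractf)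
qed

text \<open>The informations of the region, for an unnormalised input law \<open>q\<close>. They are homogeneous of degree one, so
  an information conditioned on \<open>T\<close> is the plain sum of the functional over the slices \<open>q t = p (t, _, _)\<close>.\<close>

definition rate1 :: "('x1 \<times> 'x2 \<Rightarrow> real) \<Rightarrow> real" where
  "rate1 q = ci UNIV (joint q id) (\<lambda>((x1, x2), y, u1, u2). x1) (\<lambda>((x1, x2), y, u1, u2). (y, u2))
    (\<lambda>((x1, x2), y, u1, u2). x2)"

definition rate2 :: "('x1 \<times> 'x2 \<Rightarrow> real) \<Rightarrow> real" where
  "rate2 q = ci UNIV (joint q id) (\<lambda>((x1, x2), y, u1, u2). x2) (\<lambda>((x1, x2), y, u1, u2). (y, u1))
    (\<lambda>((x1, x2), y, u1, u2). x1)"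

definition sum_rate :: "('x1 \<times> 'x2 \<Rightarrow> real) \<Rightarrow> real" where
  "sum_rate q = ci UNIV (joint q id) (\<lambda>(x, z). x) (\<lambda>(x, z). z) (\<lambda>_. ())"

definition balance :: "('x1 \<times> 'x2 \<Rightarrow> real) \<Rightarrow> real" where
  "balance q = ci UNIV (joint q id) (\<lambda>((x1, x2), y, u1, u2). x1) (\<lambda>((x1, x2), y, u1, u2). x2)
      (\<lambda>((x1, x2), y, u1, u2). (u1, u2))
    - ci UNIV (joint q id) (\<lambda>((x1, x2), y, u1, u2). x1) (\<lambda>((x1, x2), y, u1, u2). x2) (\<lambda>_. ())"

definition output_rate :: "('x1 \<times> 'x2 \<Rightarrow> real) \<Rightarrow> real" where
  "output_rate q = ci UNIV (joint q id) (\<lambda>(x, z). x) (\<lambda>(x, y, u1, u2). y) (\<lambda>_. ())"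

text \<open>With Z the new outputs, the left side is H(Z | W2, h) - H(Z | W1, W2, h). The second
  term is the sum of the three noises. The first is at most H(Z | X2, C), in which Y_F1 contributes
  at most its own noise, and that cancels. What remains is I(X1; Y, Y_F2 | X2, C).\<close>

lemma single_letter_rate1:
  fixes x :: "'s \<Rightarrow> 'x1 \<times> 'x2"
  assumes fin: "finite S" "finite D" "C ` S \<subseteq> D" and p: "\<And>s. s \<in> S \<Longrightarrow> 0 \<le> p s"
    and C: "\<And>s. s \<in> S \<Longrightarrow> C s = cf (h s)"
    and x: "\<And>s. s \<in> S \<Longrightarrow> x s = (e1 (w1 s) (C s), e2 (w2 s) (C s))"
  shows "ent (S \<times> UNIV) (joint p x) (\<lambda>(s, z). (w2 s, h s, z))
      - ent (S \<times> UNIV) (joint p x) (\<lambda>(s, z). (w1 s, w2 s, h s, z))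
      - (ent S p (\<lambda>s. (w2 s, h s)) - ent S p (\<lambda>s. (w1 s, w2 s, h s)))
    \<le> (\<Sum>t\<in>D. rate1 (\<lambda>v. marg S p (\<lambda>s. (x s, C s)) (v, t)))"
proof -
  let ?A = "S \<times> (UNIV :: ('y \<times> 'f1 \<times> 'f2) set)" and ?m = "joint p x"
  let ?E = "\<lambda>f. ent ?A ?m f"
  have A: "finite ?A" "\<And>a. a \<in> ?A \<Longrightarrow> 0 \<le> ?m a" using fin p by (auto intro: joint_nonneg)
  have 1: "?E (\<lambda>(s, z). ((w1 s, w2 s, h s), sel True True True z))
      = ?E (\<lambda>(s, z). (w1 s, w2 s, h s)) + noise S p x + noise1 S p x + noise2 S p x"
    using ent_output[of S p "\<lambda>s. (w1 s, w2 s, h s)" True x True True] fin p C x by auto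
  have 2: "?E (\<lambda>(s, z). ((x s, C s), sel True False True z))
      = ?E (\<lambda>(s, z). (x s, C s)) + noise S p x + noise2 S p x"
    using ent_output[of S p "\<lambda>s. (x s, C s)" True x False True] fin p by simp
  have 3: "?E (\<lambda>(s, z). (snd (x s), sel False True False z)) = ?E (\<lambda>(s, z). snd (x s)) + noise1 S p x"
    using ent_output[of S p "\<lambda>s. snd (x s)" False x True False] fin p by simp
  \<comment> \<open>\<open>snd (x s)\<close> and \<open>C s\<close> are functions of
    \<open>(w2 s, h s)\<close>, so adjoining them changes nothing; then \<open>(w2 s, h s)\<close>
    is dropped from the condition.\<close>
  have 4: "?E (\<lambda>a. (snd a, (w2 (fst a), h (fst a)), (snd (x (fst a)), C (fst a))))
        - ?E (\<lambda>a. ((w2 (fst a), h (fst a)), (snd (x (fst a)), C (fst a))))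
      \<le> ?E (\<lambda>a. (snd a, (snd (x (fst a)), C (fst a)))) - ?E (\<lambda>a. (snd (x (fst a)), C (fst a)))"
    by (rule ent_submodular[OF A])
  \<comment> \<open>Given X2 and anything further, Y_F1 has at most the entropy it has given X2,
    which is \<open>noise1\<close> by \<open>3\<close>.\<close>
  have 5: "?E (\<lambda>a. (fst (snd (snd a)), (C (fst a), fst (snd a), snd (snd (snd a))), snd (x (fst a))))
        - ?E (\<lambda>a. ((C (fst a), fst (snd a), snd (snd (snd a))), snd (x (fst a))))
      \<le> ?E (\<lambda>a. (fst (snd (snd a)), snd (x (fst a)))) - ?E (\<lambda>a. snd (x (fst a)))"
    by (rule ent_submodular[OF A])
  have c: "?E (\<lambda>(s, z). ((w1 s, w2 s, h s), sel True True True z)) = ?E (\<lambda>(s, z). (w1 s, w2 s, h s, z))"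
    "?E (\<lambda>a. (snd a, (w2 (fst a), h (fst a)), (snd (x (fst a)), C (fst a)))) = ?E (\<lambda>(s, z). (w2 s, h s, z))"
    "?E (\<lambda>a. ((w2 (fst a), h (fst a)), (snd (x (fst a)), C (fst a)))) = ?E (\<lambda>(s, z). (w2 s, h s))"
    "?E (\<lambda>a. (fst (snd (snd a)), (C (fst a), fst (snd a), snd (snd (snd a))), snd (x (fst a))))
      = ?E (\<lambda>a. (snd a, (snd (x (fst a)), C (fst a))))"
    "?E (\<lambda>a. (fst (snd (snd a)), snd (x (fst a)))) = ?E (\<lambda>(s, z). (snd (x s), sel False True False z))"
    "?E (\<lambda>a. snd (x (fst a))) = ?E (\<lambda>(s, z). snd (x s))"
    by (rule ent_cong; auto simp: C x)+
  have "ci ?A ?m (\<lambda>(s, z). (\<lambda>((x1, x2), y, u1, u2). x1) (x s, z))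
      (\<lambda>(s, z). (\<lambda>((x1, x2), y, u1, u2). (y, u2)) (x s, z))
      (\<lambda>(s, z). ((\<lambda>((x1, x2), y, u1, u2). x2) (x s, z), C s))
    = ?E (\<lambda>(s, z). (x s, C s)) + ?E (\<lambda>a. ((C (fst a), fst (snd a), snd (snd (snd a))), snd (x (fst a))))
      - ?E (\<lambda>a. (snd (x (fst a)), C (fst a))) - ?E (\<lambda>(s, z). ((x s, C s), sel True False True z))"
    unfolding ci_def
    by (intro arg_cong2[where f = "(+)"] arg_cong2[where f = "(-)"] ent_cong)
       (auto simp: case_prod_unfold prod_eq_iff)
  then have "(\<Sum>t\<in>D. rate1 (\<lambda>v. marg S p (\<lambda>s. (x s, C s)) (v, t))) = \<dots>"
    unfolding rate1_def ci_slices[OF fin, symmetric] .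
  then show ?thesis
    using 1 2 3 4 5 ent_joint_fst[OF fin(1), of p x "\<lambda>s. (w2 s, h s)"]
      ent_joint_fst[OF fin(1), of p x "\<lambda>s. (w1 s, w2 s, h s)"] unfolding c by linarith
qed

text \<open>\<open>single_letter_rate1\<close> with the transmitters exchanged; the output removed
  is now Y_F2, whose noise depends on X1.\<close>

lemma single_letter_rate2:
  fixes x :: "'s \<Rightarrow> 'x1 \<times> 'x2"
  assumes fin: "finite S" "finite D" "C ` S \<subseteq> D" and p: "\<And>s. s \<in> S \<Longrightarrow> 0 \<le> p s"
    and C: "\<And>s. s \<in> S \<Longrightarrow> C s = cf (h s)"
    and x: "\<And>s. s \<in> S \<Longrightarrow> x s = (e1 (w1 s) (C s), e2 (w2 s) (C s))"
  shows "ent (S \<times> UNIV) (joint p x) (\<lambda>(s, z). (w1 s, h s, z))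
      - ent (S \<times> UNIV) (joint p x) (\<lambda>(s, z). (w1 s, w2 s, h s, z))
      - (ent S p (\<lambda>s. (w1 s, h s)) - ent S p (\<lambda>s. (w1 s, w2 s, h s)))
    \<le> (\<Sum>t\<in>D. rate2 (\<lambda>v. marg S p (\<lambda>s. (x s, C s)) (v, t)))"
proof -
  let ?A = "S \<times> (UNIV :: ('y \<times> 'f1 \<times> 'f2) set)" and ?m = "joint p x"
  let ?E = "\<lambda>f. ent ?A ?m f"
  have A: "finite ?A" "\<And>a. a \<in> ?A \<Longrightarrow> 0 \<le> ?m a" using fin p by (auto intro: joint_nonneg)
  have 1: "?E (\<lambda>(s, z). ((w1 s, w2 s, h s), sel True True True z))
      = ?E (\<lambda>(s, z). (w1 s, w2 s, h s)) + noise S p x + noise1 S p x + noise2 S p x"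
    using ent_output[of S p "\<lambda>s. (w1 s, w2 s, h s)" True x True True] fin p C x by auto
  have 2: "?E (\<lambda>(s, z). ((x s, C s), sel True True False z))
      = ?E (\<lambda>(s, z). (x s, C s)) + noise S p x + noise1 S p x"
    using ent_output[of S p "\<lambda>s. (x s, C s)" True x True False] fin p by simp
  have 3: "?E (\<lambda>(s, z). (fst (x s), sel False False True z)) = ?E (\<lambda>(s, z). fst (x s)) + noise2 S p x"
    using ent_output[of S p "\<lambda>s. fst (x s)" False x False True] fin p by simp
  have 4: "?E (\<lambda>a. (snd a, (w1 (fst a), h (fst a)), (fst (x (fst a)), C (fst a))))
        - ?E (\<lambda>a. ((w1 (fst a), h (fst a)), (fst (x (fst a)), C (fst a))))
      \<le> ?E (\<lambda>a. (snd a, (fst (x (fst a)), C (fst a)))) - ?E (\<lambda>a. (fst (x (fst a)), C (fst a)))"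
    by (rule ent_submodular[OF A])
  have 5: "?E (\<lambda>a. (snd (snd (snd a)), (C (fst a), fst (snd a), fst (snd (snd a))), fst (x (fst a))))
        - ?E (\<lambda>a. ((C (fst a), fst (snd a), fst (snd (snd a))), fst (x (fst a))))
      \<le> ?E (\<lambda>a. (snd (snd (snd a)), fst (x (fst a)))) - ?E (\<lambda>a. fst (x (fst a)))"
    by (rule ent_submodular[OF A])
  have c: "?E (\<lambda>(s, z). ((w1 s, w2 s, h s), sel True True True z)) = ?E (\<lambda>(s, z). (w1 s, w2 s, h s, z))"
    "?E (\<lambda>a. (snd a, (w1 (fst a), h (fst a)), (fst (x (fst a)), C (fst a)))) = ?E (\<lambda>(s, z). (w1 s, h s, z))"
    "?E (\<lambda>a. ((w1 (fst a), h (fst a)), (fst (x (fst a)), C (fst a)))) = ?E (\<lambda>(s, z). (w1 s, h s))"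
    "?E (\<lambda>a. (snd (snd (snd a)), (C (fst a), fst (snd a), fst (snd (snd a))), fst (x (fst a))))
      = ?E (\<lambda>a. (snd a, (fst (x (fst a)), C (fst a))))"
    "?E (\<lambda>a. (snd (snd (snd a)), fst (x (fst a)))) = ?E (\<lambda>(s, z). (fst (x s), sel False False True z))"
    "?E (\<lambda>a. fst (x (fst a))) = ?E (\<lambda>(s, z). fst (x s))"
    by (rule ent_cong; auto simp: C x)+
  have "ci ?A ?m (\<lambda>(s, z). (\<lambda>((x1, x2), y, u1, u2). x2) (x s, z))
      (\<lambda>(s, z). (\<lambda>((x1, x2), y, u1, u2). (y, u1)) (x s, z))
      (\<lambda>(s, z). ((\<lambda>((x1, x2), y, u1, u2). x1) (x s, z), C s))
    = ?E (\<lambda>(s, z). (x s, C s)) + ?E (\<lambda>a. ((C (fst a), fst (snd a), fst (snd (snd a))), fst (x (fst a))))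
      - ?E (\<lambda>a. (fst (x (fst a)), C (fst a))) - ?E (\<lambda>(s, z). ((x s, C s), sel True True False z))"
    unfolding ci_def
    by (intro arg_cong2[where f = "(+)"] arg_cong2[where f = "(-)"] ent_cong)
       (auto simp: case_prod_unfold prod_eq_iff)
  then have "(\<Sum>t\<in>D. rate2 (\<lambda>v. marg S p (\<lambda>s. (x s, C s)) (v, t))) = \<dots>"
    unfolding rate2_def ci_slices[OF fin, symmetric] .
  then show ?thesis
    using 1 2 3 4 5 ent_joint_fst[OF fin(1), of p x "\<lambda>s. (w1 s, h s)"]
      ent_joint_fst[OF fin(1), of p x "\<lambda>s. (w1 s, w2 s, h s)"] unfolding c by linarith
qed

lemma single_letter_sum_rate:
  fixes x :: "'s \<Rightarrow> 'x1 \<times> 'x2"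
  assumes fin: "finite S" "finite D" "C ` S \<subseteq> D" and p: "\<And>s. s \<in> S \<Longrightarrow> 0 \<le> p s"
    and C: "\<And>s. s \<in> S \<Longrightarrow> C s = cf (h s)"
    and x: "\<And>s. s \<in> S \<Longrightarrow> x s = (e1 (w1 s) (C s), e2 (w2 s) (C s))"
  shows "ent (S \<times> UNIV) (joint p x) (\<lambda>(s, z). (h s, z))
      - ent (S \<times> UNIV) (joint p x) (\<lambda>(s, z). (w1 s, w2 s, h s, z))
      - (ent S p h - ent S p (\<lambda>s. (w1 s, w2 s, h s)))
    \<le> (\<Sum>t\<in>D. sum_rate (\<lambda>v. marg S p (\<lambda>s. (x s, C s)) (v, t)))"
proof -
  let ?A = "S \<times> (UNIV :: ('y \<times> 'f1 \<times> 'f2) set)" and ?m = "joint p x"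
  let ?E = "\<lambda>f. ent ?A ?m f"
  have A: "finite ?A" "\<And>a. a \<in> ?A \<Longrightarrow> 0 \<le> ?m a" using fin p by (auto intro: joint_nonneg)
  have 1: "?E (\<lambda>(s, z). ((w1 s, w2 s, h s), sel True True True z))
      = ?E (\<lambda>(s, z). (w1 s, w2 s, h s)) + noise S p x + noise1 S p x + noise2 S p x"
    using ent_output[of S p "\<lambda>s. (w1 s, w2 s, h s)" True x True True] fin p C x by auto
  have 2: "?E (\<lambda>(s, z). ((x s, C s), sel True True True z))
      = ?E (\<lambda>(s, z). (x s, C s)) + noise S p x + noise1 S p x + noise2 S p x"
    using ent_output[of S p "\<lambda>s. (x s, C s)" True x True True] fin p by simp
  have 4: "?E (\<lambda>a. (snd a, h (fst a), C (fst a))) - ?E (\<lambda>a. (h (fst a), C (fst a)))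
      \<le> ?E (\<lambda>a. (snd a, C (fst a))) - ?E (\<lambda>a. C (fst a))"
    by (rule ent_submodular[OF A])
  have c: "?E (\<lambda>(s, z). ((w1 s, w2 s, h s), sel True True True z)) = ?E (\<lambda>(s, z). (w1 s, w2 s, h s, z))"
    "?E (\<lambda>a. (snd a, h (fst a), C (fst a))) = ?E (\<lambda>(s, z). (h s, z))"
    "?E (\<lambda>a. (h (fst a), C (fst a))) = ?E (\<lambda>(s, z). h s)"
    by (rule ent_cong; auto simp: C x)+
  have "ci ?A ?m (\<lambda>(s, z). (\<lambda>(x, z). x) (x s, z)) (\<lambda>(s, z). (\<lambda>(x, z). z) (x s, z))
      (\<lambda>(s, z). ((\<lambda>_. ()) (x s, z), C s))
    = ?E (\<lambda>(s, z). (x s, C s)) + ?E (\<lambda>a. (snd a, C (fst a)))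
      - ?E (\<lambda>a. C (fst a)) - ?E (\<lambda>(s, z). ((x s, C s), sel True True True z))"
    unfolding ci_def
    by (intro arg_cong2[where f = "(+)"] arg_cong2[where f = "(-)"] ent_cong)
       (auto simp: case_prod_unfold prod_eq_iff)
  then have "(\<Sum>t\<in>D. sum_rate (\<lambda>v. marg S p (\<lambda>s. (x s, C s)) (v, t))) = \<dots>"
    unfolding sum_rate_def ci_slices[OF fin, symmetric] .
  then show ?thesis
    using 1 2 4 ent_joint_fst[OF fin(1), of p x h]
      ent_joint_fst[OF fin(1), of p x "\<lambda>s. (w1 s, w2 s, h s)"] unfolding c by linarith
qed

text \<open>With F the new feedback pair, the left side is H(F | W1, C) + H(F | W2, C) - H(F | C) -
  H(F | W1, W2, C). The first two terms can only grow when W1, W2 become X1, X2; the last does not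
  change, because the messages and \<open>C\<close> determine the inputs.\<close>

lemma single_letter_balance:
  fixes x :: "'s \<Rightarrow> 'x1 \<times> 'x2"
  assumes fin: "finite S" "finite D" "C ` S \<subseteq> D" and p: "\<And>s. s \<in> S \<Longrightarrow> 0 \<le> p s"
    and x: "\<And>s. s \<in> S \<Longrightarrow> x s = (e1 (w1 s) (C s), e2 (w2 s) (C s))"
  shows "ent (S \<times> UNIV) (joint p x) (\<lambda>(s, z). (w1 s, C s, snd z))
      + ent (S \<times> UNIV) (joint p x) (\<lambda>(s, z). (w2 s, C s, snd z))
      - ent (S \<times> UNIV) (joint p x) (\<lambda>(s, z). (C s, snd z))
      - ent (S \<times> UNIV) (joint p x) (\<lambda>(s, z). (w1 s, w2 s, C s, snd z))
      - (ent S p (\<lambda>s. (w1 s, C s)) + ent S p (\<lambda>s. (w2 s, C s)) - ent S p C - ent S p (\<lambda>s. (w1 s, w2 s, C s)))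
    \<le> (\<Sum>t\<in>D. balance (\<lambda>v. marg S p (\<lambda>s. (x s, C s)) (v, t)))"
proof -
  let ?A = "S \<times> (UNIV :: ('y \<times> 'f1 \<times> 'f2) set)" and ?m = "joint p x"
  let ?E = "\<lambda>f. ent ?A ?m f"
  have A: "finite ?A" "\<And>a. a \<in> ?A \<Longrightarrow> 0 \<le> ?m a" using fin p by (auto intro: joint_nonneg)
  have 1: "?E (\<lambda>(s, z). ((w1 s, w2 s, C s), sel False True True z))
      = ?E (\<lambda>(s, z). (w1 s, w2 s, C s)) + noise1 S p x + noise2 S p x"
    using ent_output[of S p "\<lambda>s. (w1 s, w2 s, C s)" False x True True] fin p x by auto
  have 2: "?E (\<lambda>(s, z). ((x s, C s), sel False True True z))
      = ?E (\<lambda>(s, z). (x s, C s)) + noise1 S p x + noise2 S p x"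
    using ent_output[of S p "\<lambda>s. (x s, C s)" False x True True] fin p by simp
  have 3: "?E (\<lambda>a. (snd (snd a), w1 (fst a), (fst (x (fst a)), C (fst a))))
        - ?E (\<lambda>a. (w1 (fst a), (fst (x (fst a)), C (fst a))))
      \<le> ?E (\<lambda>a. (snd (snd a), (fst (x (fst a)), C (fst a)))) - ?E (\<lambda>a. (fst (x (fst a)), C (fst a)))"
    by (rule ent_submodular[OF A])
  have 4: "?E (\<lambda>a. (snd (snd a), w2 (fst a), (snd (x (fst a)), C (fst a))))
        - ?E (\<lambda>a. (w2 (fst a), (snd (x (fst a)), C (fst a))))
      \<le> ?E (\<lambda>a. (snd (snd a), (snd (x (fst a)), C (fst a)))) - ?E (\<lambda>a. (snd (x (fst a)), C (fst a)))"
    by (rule ent_submodular[OF A])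
  have c: "?E (\<lambda>(s, z). ((w1 s, w2 s, C s), sel False True True z)) = ?E (\<lambda>(s, z). (w1 s, w2 s, C s, snd z))"
    "?E (\<lambda>a. (snd (snd a), w1 (fst a), (fst (x (fst a)), C (fst a)))) = ?E (\<lambda>(s, z). (w1 s, C s, snd z))"
    "?E (\<lambda>a. (snd (snd a), w2 (fst a), (snd (x (fst a)), C (fst a)))) = ?E (\<lambda>(s, z). (w2 s, C s, snd z))"
    "?E (\<lambda>a. (w1 (fst a), (fst (x (fst a)), C (fst a)))) = ?E (\<lambda>(s, z). (w1 s, C s))"
    "?E (\<lambda>a. (w2 (fst a), (snd (x (fst a)), C (fst a)))) = ?E (\<lambda>(s, z). (w2 s, C s))"
    by (rule ent_cong; auto simp: x)+
  have "ci ?A ?m (\<lambda>(s, z). (\<lambda>((x1, x2), y, u1, u2). x1) (x s, z))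
      (\<lambda>(s, z). (\<lambda>((x1, x2), y, u1, u2). x2) (x s, z))
      (\<lambda>(s, z). ((\<lambda>((x1, x2), y, u1, u2). (u1, u2)) (x s, z), C s))
    = ?E (\<lambda>a. (snd (snd a), (fst (x (fst a)), C (fst a)))) + ?E (\<lambda>a. (snd (snd a), (snd (x (fst a)), C (fst a))))
      - ?E (\<lambda>(s, z). (C s, snd z)) - ?E (\<lambda>(s, z). ((x s, C s), sel False True True z))"
    unfolding ci_def
    by (intro arg_cong2[where f = "(+)"] arg_cong2[where f = "(-)"] ent_cong)
       (auto simp: case_prod_unfold prod_eq_iff)
  moreover have "ci ?A ?m (\<lambda>(s, z). (\<lambda>((x1, x2), y, u1, u2). x1) (x s, z))
      (\<lambda>(s, z). (\<lambda>((x1, x2), y, u1, u2). x2) (x s, z)) (\<lambda>(s, z). ((\<lambda>_. ()) (x s, z), C s))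
    = ?E (\<lambda>a. (fst (x (fst a)), C (fst a))) + ?E (\<lambda>a. (snd (x (fst a)), C (fst a)))
      - ?E (\<lambda>(s, z). C s) - ?E (\<lambda>(s, z). (x s, C s))"
    unfolding ci_def
    by (intro arg_cong2[where f = "(+)"] arg_cong2[where f = "(-)"] ent_cong)
       (auto simp: case_prod_unfold prod_eq_iff)
  ultimately have "(\<Sum>t\<in>D. balance (\<lambda>v. marg S p (\<lambda>s. (x s, C s)) (v, t))) =
     ?E (\<lambda>a. (snd (snd a), (fst (x (fst a)), C (fst a)))) + ?E (\<lambda>a. (snd (snd a), (snd (x (fst a)), C (fst a))))
      - ?E (\<lambda>(s, z). (C s, snd z)) - ?E (\<lambda>(s, z). ((x s, C s), sel False True True z))
     - (?E (\<lambda>a. (fst (x (fst a)), C (fst a))) + ?E (\<lambda>a. (snd (x (fst a)), C (fst a)))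
      - ?E (\<lambda>(s, z). C s) - ?E (\<lambda>(s, z). (x s, C s)))"
    unfolding balance_def sum_subtractf ci_slices[OF fin, symmetric] by (simp only:)
  then show ?thesis
    using 1 2 3 4 ent_joint_fst[OF fin(1), of p x C]
      ent_joint_fst[OF fin(1), of p x "\<lambda>s. (w1 s, w2 s, C s)"]
      ent_joint_fst[OF fin(1), of p x "\<lambda>s. (w1 s, C s)"]
      ent_joint_fst[OF fin(1), of p x "\<lambda>s. (w2 s, C s)"] unfolding c by linarith
qed

text \<open>The entropy of a constant is - m ln m for total mass m, so for unnormalised weights it
  must stay in I(X; Y) = H(Y) - H(Y | X).\<close>

lemma output_rate_marg:
  fixes x :: "'s \<Rightarrow> 'x1 \<times> 'x2"
  assumes fin: "finite S" and p: "\<And>s. s \<in> S \<Longrightarrow> 0 \<le> p s"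
  shows "output_rate (marg S p x) = ent (S \<times> UNIV) (joint p x) (\<lambda>(s, z). fst z)
    - ent (S \<times> UNIV) (joint p x) (\<lambda>_. ()) - noise S p x"
proof -
  let ?A = "S \<times> (UNIV :: ('y \<times> 'f1 \<times> 'f2) set)" and ?m = "joint p x"
  let ?E = "\<lambda>f. ent ?A ?m f"
  \<comment> \<open>A one-point \<open>C\<close> turns \<open>ci_slices\<close> into a statement
    about a single slice.\<close>
  have sub: "(\<lambda>_. ()) ` S \<subseteq> {()}" by auto
  have m: "marg S p (\<lambda>s. (x s, ())) (v, ()) = marg S p x v" for v
    by (simp add: marg_def)
  have "ci ?A ?m (\<lambda>(s, z). (\<lambda>(x, z). x) (x s, z)) (\<lambda>(s, z). (\<lambda>(x, y, u1, u2). y) (x s, z))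
      (\<lambda>(s, z). ((\<lambda>_. ()) (x s, z), ()))
    = ?E (\<lambda>(s, z). x s) + ?E (\<lambda>(s, z). fst z) - ?E (\<lambda>_. ()) - ?E (\<lambda>(s, z). (x s, sel True False False z))"
    unfolding ci_def
    by (intro arg_cong2[where f = "(+)"] arg_cong2[where f = "(-)"] ent_cong)
       (auto simp: case_prod_unfold prod_eq_iff)
  then have "output_rate (marg S p x) = \<dots>"
    using ci_slices[OF fin, of "{()}" "\<lambda>_. ()", OF _ sub, where p = p and x = x and f = "\<lambda>(x, z). x"
        and g = "\<lambda>(x, y, u1, u2). y" and h = "\<lambda>_. ()"]
    by (simp add: output_rate_def m)
  then show ?thesis
    using ent_output[of S p x True x False False] fin p by simp
qed

text \<open>\<open>k\<close> is what the receiver has seen and does not determine the input. Adding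
  the whole past \<open>h\<close> to the condition lowers the subtracted entropy to
  \<open>noise\<close>, and dropping \<open>k\<close> raises the other one.\<close>

lemma single_letter_output_rate:
  fixes x :: "'s \<Rightarrow> 'x1 \<times> 'x2"
  assumes fin: "finite S" and p: "\<And>s. s \<in> S \<Longrightarrow> 0 \<le> p s"
    and k: "\<And>s. s \<in> S \<Longrightarrow> k s = kf (h s)"
    and x: "\<And>s. s \<in> S \<Longrightarrow> x s = xf (w s) (h s)"
  shows "ent (S \<times> UNIV) (joint p x) (\<lambda>(s, z). (k s, fst z))
      - ent (S \<times> UNIV) (joint p x) (\<lambda>(s, z). (w s, k s, fst z))
      - (ent S p k - ent S p (\<lambda>s. (w s, k s)))
    \<le> output_rate (marg S p x)"
proof -
  let ?A = "S \<times> (UNIV :: ('y \<times> 'f1 \<times> 'f2) set)" and ?m = "joint p x"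
  let ?E = "\<lambda>f. ent ?A ?m f"
  have A: "finite ?A" "\<And>a. a \<in> ?A \<Longrightarrow> 0 \<le> ?m a" using fin p by (auto intro: joint_nonneg)
  have 1: "?E (\<lambda>(s, z). ((w s, h s), sel True False False z)) = ?E (\<lambda>(s, z). (w s, h s)) + noise S p x"
    using ent_output[of S p "\<lambda>s. (w s, h s)" True x False False] fin p x by auto
  have 2: "?E (\<lambda>a. (fst (snd a), h (fst a), (w (fst a), k (fst a)))) - ?E (\<lambda>a. (h (fst a), (w (fst a), k (fst a))))
      \<le> ?E (\<lambda>a. (fst (snd a), (w (fst a), k (fst a)))) - ?E (\<lambda>a. (w (fst a), k (fst a)))"
    by (rule ent_submodular[OF A])
  have 3: "?E (\<lambda>a. (fst (snd a), k (fst a), ())) - ?E (\<lambda>a. (k (fst a), ()))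
      \<le> ?E (\<lambda>a. (fst (snd a), ())) - ?E (\<lambda>a. ())"
    by (rule ent_submodular[OF A])
  have c: "?E (\<lambda>(s, z). ((w s, h s), sel True False False z)) = ?E (\<lambda>a. (fst (snd a), h (fst a), (w (fst a), k (fst a))))"
    "?E (\<lambda>(s, z). (w s, h s)) = ?E (\<lambda>a. (h (fst a), (w (fst a), k (fst a))))"
    "?E (\<lambda>a. (fst (snd a), (w (fst a), k (fst a)))) = ?E (\<lambda>(s, z). (w s, k s, fst z))"
    "?E (\<lambda>a. (w (fst a), k (fst a))) = ?E (\<lambda>(s, z). (w s, k s))"
    "?E (\<lambda>a. (fst (snd a), k (fst a), ())) = ?E (\<lambda>(s, z). (k s, fst z))"
    "?E (\<lambda>a. (k (fst a), ())) = ?E (\<lambda>(s, z). k s)"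
    "?E (\<lambda>a. (fst (snd a), ())) = ?E (\<lambda>(s, z). fst z)"
    by (rule ent_cong; auto simp: k x)+
  show ?thesis
    using 1 2 3 output_rate_marg[of S p x, OF fin p] ent_joint_fst[OF fin(1), of p x k]
      ent_joint_fst[OF fin(1), of p x "\<lambda>s. (w s, k s)"] unfolding c by linarith
qed

text \<open>Concavity of I(X; Y) in the input law, in homogeneous form. With the index as an
  auxiliary variable both sides have the same noise, and conditioning on the index can only lower
  the output entropy.\<close>

lemma output_rate_superadditive:
  assumes I: "finite I" and q: "\<And>i v. i \<in> I \<Longrightarrow> 0 \<le> q i v"
  shows "(\<Sum>i\<in>I. output_rate (q i)) \<le> output_rate (\<lambda>v. \<Sum>i\<in>I. q i v)"
proof -
  let ?S = "I \<times> (UNIV :: ('x1 \<times> 'x2) set)" and ?p = "\<lambda>(i, v). q i v"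
  let ?A = "?S \<times> (UNIV :: ('y \<times> 'f1 \<times> 'f2) set)" and ?m = "joint ?p snd"
  let ?E = "\<lambda>f. ent ?A ?m f"
  have fin: "finite ?S" and p: "\<And>s. s \<in> ?S \<Longrightarrow> 0 \<le> ?p s" using I q by auto
  have A: "finite ?A" "\<And>a. a \<in> ?A \<Longrightarrow> 0 \<le> ?m a" using fin joint_nonneg[of ?S ?p] p by auto
  have m: "marg ?S ?p (\<lambda>s. (snd s, fst s)) (v, i) = q i v" if "i \<in> I" for v i
  proof -
    have "{a \<in> ?S. (snd a, fst a) = (v, i)} = {(i, v)}" using that by auto
    then show ?thesis by (simp add: marg_def)
  qed
  have m': "marg ?S ?p snd = (\<lambda>v. \<Sum>i\<in>I. q i v)"
  proof
    fix v have "{a \<in> ?S. snd a = v} = (\<lambda>i. (i, v)) ` I" by auto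
    then show "marg ?S ?p snd v = (\<Sum>i\<in>I. q i v)" by (simp add: marg_def sum.reindex inj_on_def)
  qed
  have "ci ?A ?m (\<lambda>(s, z). (\<lambda>(x, z). x) (snd s, z)) (\<lambda>(s, z). (\<lambda>(x, y, u1, u2). y) (snd s, z))
      (\<lambda>(s, z). ((\<lambda>_. ()) (snd s, z), fst s))
    = ?E (\<lambda>(s, z). s) + ?E (\<lambda>a. (fst (snd a), fst (fst a), ())) - ?E (\<lambda>a. (fst (fst a), ()))
      - ?E (\<lambda>(s, z). (s, sel True False False z))"
    unfolding ci_def
    by (intro arg_cong2[where f = "(+)"] arg_cong2[where f = "(-)"] ent_cong)
       (auto simp: case_prod_unfold prod_eq_iff)
  then have 1: "(\<Sum>i\<in>I. output_rate (q i)) = \<dots>"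
    using ci_slices[of ?S I fst ?p snd "\<lambda>(x, z). x" "\<lambda>(x, y, u1, u2). y" "\<lambda>_. ()"] fin I
    unfolding output_rate_def by (auto simp: m cong: sum.cong)
  have 2: "?E (\<lambda>(s, z). (s, sel True False False z)) = ?E (\<lambda>(s, z). s) + noise ?S ?p snd"
    using ent_output[of ?S ?p "\<lambda>s. s" True snd False False] fin p by auto
  have 3: "?E (\<lambda>a. (fst (snd a), fst (fst a), ())) - ?E (\<lambda>a. (fst (fst a), ()))
      \<le> ?E (\<lambda>a. (fst (snd a), ())) - ?E (\<lambda>a. ())"
    by (rule ent_submodular[OF A])
  have c: "?E (\<lambda>a. (fst (snd a), ())) = ?E (\<lambda>(s, z). fst z)"
    by (rule ent_cong) auto
  show ?thesis
    using output_rate_marg[of ?S ?p snd, OF fin p] 1 2 3 unfolding c m' by linarith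
qed

lemma ci_scale:
  assumes "finite A" "0 \<le> c" "\<And>a. a \<in> A \<Longrightarrow> 0 \<le> m a"
  shows "ci A (\<lambda>a. c * m a) X Y Z = c * ci A m X Y Z"
  unfolding ci_def by (simp add: ent_scale[OF assms] algebra_simps)

lemma joint_scale: "joint (\<lambda>v. c * q v) id = (\<lambda>a. c * joint q id a)"
  by (auto simp: joint_def)

text \<open>Applied with \<open>c = 1 / n\<close> to normalise a block, with the weights of the
  linear program, and with \<open>c = 0\<close> for empty slices.\<close>

lemma functionals_scale:
  assumes "0 \<le> c" "\<And>v. 0 \<le> q v"
  shows "rate1 (\<lambda>v. c * q v) = c * rate1 q" "rate2 (\<lambda>v. c * q v) = c * rate2 q"
    "sum_rate (\<lambda>v. c * q v) = c * sum_rate q" "balance (\<lambda>v. c * q v) = c * balance q"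
    "output_rate (\<lambda>v. c * q v) = c * output_rate q"
proof -
  have "0 \<le> joint q id a" for a :: "('x1 \<times> 'x2) \<times> 'y \<times> 'f1 \<times> 'f2"
    using joint_nonneg[of UNIV q a] assms(2) by simp
  note * = ci_scale[OF finite_class.finite_UNIV assms(1) this]
  show "rate1 (\<lambda>v. c * q v) = c * rate1 q" "rate2 (\<lambda>v. c * q v) = c * rate2 q"
    "sum_rate (\<lambda>v. c * q v) = c * sum_rate q" "balance (\<lambda>v. c * q v) = c * balance q"
    "output_rate (\<lambda>v. c * q v) = c * output_rate q"
    unfolding rate1_def rate2_def sum_rate_def balance_def output_rate_def joint_scale * by (simp_all add: right_diff_distrib)
qed

end

section \<open>Continuity of the functionals\<close>

lemma tendsto_mult_ln:
  fixes X :: "nat \<Rightarrow> real"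
  assumes X: "X \<longlonglongrightarrow> l" and nn: "\<And>n. 0 \<le> X n"
  shows "(\<lambda>n. X n * ln (X n)) \<longlonglongrightarrow> l * ln l"
proof (cases "l = 0")
  case False
  then show ?thesis using X by (intro tendsto_intros) auto
next
  case True
  \<comment> \<open>Continuity of \<open>ln\<close> fails at 0, so \<open>x * ln x\<close> is
    squeezed by a continuous function that vanishes there.\<close>
  have b: "\<bar>x * ln x\<bar> \<le> 2 * sqrt x + x\<^sup>2" if "0 \<le> x" for x :: real
  proof (cases "x = 0")
    case False
    then have x: "0 < x" using that by simp
    have "ln x \<le> x" using ln_less_self[OF x] by simp
    then have 1: "x * ln x \<le> x\<^sup>2" using x by (simp add: power2_eq_square)
    \<comment> \<open>The argument \<open>1 / sqrt x\<close> yields a singularity of order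
      \<open>1 / sqrt x\<close>, which the factor \<open>x\<close> absorbs.\<close>
    have "ln (1 / sqrt x) \<le> 1 / sqrt x" by (rule less_imp_le[OF ln_less_self]) (use x in simp)
    then have "- ln x \<le> 2 / sqrt x" using x by (simp add: ln_div ln_sqrt)
    then have "x * - ln x \<le> x * (2 / sqrt x)" using x by (intro mult_left_mono) auto
    also have "\<dots> = 2 * sqrt x" using x by (simp add: field_simps)
    finally show ?thesis using 1 x real_sqrt_ge_zero[of x] zero_le_power2[of x] by (simp only: abs_le_iff) linarith
  qed simp
  have "(\<lambda>n. 2 * sqrt (X n) + (X n)\<^sup>2) \<longlonglongrightarrow> 2 * sqrt l + l\<^sup>2"
    by (intro tendsto_intros X)
  then have "(\<lambda>n. 2 * sqrt (X n) + (X n)\<^sup>2) \<longlonglongrightarrow> 0" using True by simp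
  then have "(\<lambda>n. X n * ln (X n)) \<longlonglongrightarrow> 0"
    by (rule Lim_null_comparison[rotated]) (auto intro!: eventuallyI b nn)
  then show ?thesis using True by simp
qed

lemma tendsto_ent:
  assumes "finite A" "\<And>a. a \<in> A \<Longrightarrow> (\<lambda>n. m n a) \<longlonglongrightarrow> l a" "\<And>n a. a \<in> A \<Longrightarrow> 0 \<le> m n a"
  shows "(\<lambda>n. ent A (m n) f) \<longlonglongrightarrow> ent A l f"
proof -
  have e: "ent A m f = - (\<Sum>v\<in>f ` A. marg A m f v * ln (marg A m f v))" for m :: "'a \<Rightarrow> real"
    using assms(1) by (intro ent_eq_sum_marg) auto
  have "(\<lambda>n. marg A (m n) f v) \<longlonglongrightarrow> marg A l f v" for v
    unfolding marg_def using assms by (intro tendsto_sum) auto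
  then show ?thesis
    unfolding e using assms by (intro tendsto_intros tendsto_mult_ln marg_nonneg) auto
qed

context separable_mac
begin

lemma tendsto_ent_joint:
  assumes q: "\<And>v. (\<lambda>n. q n v) \<longlonglongrightarrow> l v" "\<And>n v. 0 \<le> q n v"
  shows "(\<lambda>n. ent UNIV (joint (q n) id) f) \<longlonglongrightarrow> ent UNIV (joint l id) f"
proof (rule tendsto_ent)
  show "(\<lambda>n. joint (q n) id a) \<longlonglongrightarrow> joint l id a" for a :: "('x1 \<times> 'x2) \<times> 'y \<times> 'f1 \<times> 'f2"
    by (cases a) (auto simp: joint_def intro!: tendsto_intros q)
  show "0 \<le> joint (q n) id a" for n and a :: "('x1 \<times> 'x2) \<times> 'y \<times> 'f1 \<times> 'f2"
    using joint_nonneg[of UNIV "q n" a] q(2) by simp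
qed simp

lemma tendsto_functionals:
  assumes q: "\<And>v. (\<lambda>n. q n v) \<longlonglongrightarrow> l v" "\<And>n v. 0 \<le> q n v"
  shows "(\<lambda>n. rate1 (q n)) \<longlonglongrightarrow> rate1 l" "(\<lambda>n. rate2 (q n)) \<longlonglongrightarrow> rate2 l"
    "(\<lambda>n. sum_rate (q n)) \<longlonglongrightarrow> sum_rate l" "(\<lambda>n. balance (q n)) \<longlonglongrightarrow> balance l"
    "(\<lambda>n. output_rate (q n)) \<longlonglongrightarrow> output_rate l"
  unfolding rate1_def rate2_def sum_rate_def balance_def output_rate_def ci_def
  by (intro tendsto_add tendsto_diff tendsto_ent_joint q)+

end

subsection \<open>Block codes\<close>

text \<open>\<open>k\<close> is an injective pairing, so the outcome reveals both stages and a
  single term of the mixture contributes.\<close>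

lemma pmf_bind_map_pmf:
  assumes k: "\<And>a b a' b'. k a b = k a' b' \<longleftrightarrow> a = a' \<and> b = b'"
  shows "pmf (bind_pmf p (\<lambda>a. map_pmf (k a) (f a))) (k a b) = pmf p a * pmf (f a) b"
proof -
  have "pmf (map_pmf (k x) (f x)) (k a b) = indicator {a} x * pmf (f a) b" for x
  proof (cases "x = a")
    case True
    have "inj (k a)" using k by (auto simp: inj_def)
    then show ?thesis using True by (simp add: pmf_map_inj')
  next
    case False
    then have "k a b \<notin> k x ` set_pmf (f x)" using k by auto
    then show ?thesis using False by (simp add: pmf_map_outside)
  qed
  then show ?thesis by (simp add: pmf_bind measure_pmf_single)
qed

lemma set_pmf_outputs: "h \<in> set_pmf (outputs W e1 e2 w1 w2 i) \<Longrightarrow> length h = i"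
  by (induction i arbitrary: h) auto

lemma pmf_outputs_Suc:
  "pmf (outputs W e1 e2 w1 w2 (Suc i)) (h @ [z]) = pmf (outputs W e1 e2 w1 w2 i) h *
    pmf (W (e1 (Suc i) w1 (map fst (map snd h))) (e2 (Suc i) w2 (map snd (map snd h)))) z"
  unfolding outputs.simps
  by (subst pmf_bind_map_pmf[of "\<lambda>h z. h @ [z]"]) (auto simp: comp_def case_prod_unfold)

locale coded_mac = separable_mac V V1 V2
  for V :: "'x1::finite \<Rightarrow> 'x2::finite \<Rightarrow> 'y::finite pmf"
    and V1 :: "'x2 \<Rightarrow> 'f1::finite pmf"
    and V2 :: "'x1 \<Rightarrow> 'f2::finite pmf" +
  fixes W :: "('x1, 'x2, 'y, 'f1, 'f2) mac_gf"
    and M1 M2 :: nat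
    and e1 :: "('f1, 'x1) encoder" and e2 :: "('f2, 'x2) encoder"
  assumes W: "\<And>x1 x2 z. pmf (W x1 x2) z = chan (x1, x2) z"
    and M: "1 \<le> M1" "1 \<le> M2"
begin

definition states :: "nat \<Rightarrow> ((nat \<times> nat) \<times> ('y \<times> 'f1 \<times> 'f2) list) set" where
  "states i = ({1..M1} \<times> {1..M2}) \<times> {h. length h = i}"

definition law :: "nat \<Rightarrow> (nat \<times> nat) \<times> ('y \<times> 'f1 \<times> 'f2) list \<Rightarrow> real" where
  "law i = pmf (code_law W i M1 M2 e1 e2)"

definition past :: "(nat \<times> nat) \<times> ('y \<times> 'f1 \<times> 'f2) list \<Rightarrow> ('f1 \<times> 'f2) list" where
  "past s = map snd (snd s)"

text \<open>The state after \<open>i\<close> uses determines the input of use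
  \<open>Suc i\<close>.\<close>

definition input :: "nat \<Rightarrow> (nat \<times> nat) \<times> ('y \<times> 'f1 \<times> 'f2) list \<Rightarrow> 'x1 \<times> 'x2" where
  "input i s = (e1 (Suc i) (fst (fst s)) (map fst (past s)), e2 (Suc i) (snd (fst s)) (map snd (past s)))"

text \<open>This is p(t, x1, x2) for t = (Suc i, c) times the block length, the uniform time not yet
  being weighted.\<close>

definition slice :: "nat \<Rightarrow> ('f1 \<times> 'f2) list \<Rightarrow> 'x1 \<times> 'x2 \<Rightarrow> real" where
  "slice i c v = marg (states i) (law i) (\<lambda>s. (input i s, past s)) (v, c)"

lemma finite_lists_length: "finite {h :: 'b::finite list. length h = i}"
  using finite_lists_length_eq[of "UNIV :: 'b set" i] by simp

lemma finite_states: "finite (states i)"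
  by (simp add: states_def finite_lists_length)

lemma pmf_code_law: "law i (w, h) = pmf (pair_pmf (pmf_of_set {1..M1}) (pmf_of_set {1..M2})) w
    * pmf (outputs W e1 e2 (fst w) (snd w) i) h"
  using pmf_bind_map_pmf[of Pair "pair_pmf (pmf_of_set {1..M1}) (pmf_of_set {1..M2})"
      "\<lambda>w. outputs W e1 e2 (fst w) (snd w) i" w h]
  by (simp add: law_def code_law_def case_prod_unfold)

lemma law_nonneg: "0 \<le> law i s"
  by (simp add: law_def)

lemma set_pmf_code_law: "set_pmf (code_law W i M1 M2 e1 e2) \<subseteq> states i"
  using M by (auto simp: code_law_def states_def set_pmf_outputs set_pmf_of_set)

lemma sum_law: "sum (law i) (states i) = 1"
  unfolding law_def by (intro sum_pmf_eq_1 finite_states set_pmf_code_law)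

lemma law_0: "s \<in> states 0 \<Longrightarrow> law 0 s = 1 / (real M1 * real M2)"
  using M by (cases s) (auto simp: states_def pmf_code_law pmf_pair)

lemma law_Suc: "law (Suc i) (w, h @ [z]) = law i (w, h) * chan (input i (w, h)) z"
  by (simp only: pmf_code_law pmf_outputs_Suc W input_def past_def fst_conv snd_conv mult.assoc)

text \<open>Appending a symbol is a bijection onto the longer states that carries
  \<open>joint\<close> to the next law, by \<open>law_Suc\<close>. One channel use thereby takes the
  form of the single-letter lemmas.\<close>

lemma ent_Suc:
  "ent (states (Suc i)) (law (Suc i)) f
    = ent (states i \<times> UNIV) (joint (law i) (input i)) (\<lambda>(s, z). f (fst s, snd s @ [z]))"
proof -
  let ?\<pi> = "\<lambda>(s, z). (fst s, snd s @ [z])"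
  have m: "marg (states i \<times> UNIV) (joint (law i) (input i)) ?\<pi> v = law (Suc i) v" if "v \<in> states (Suc i)" for v
  proof -
    obtain w h z where v: "v = (w, h @ [z])" "w \<in> {1..M1} \<times> {1..M2}" "length h = i"
    proof -
      obtain w h' where 1: "v = (w, h')" by (cases v)
      have 2: "w \<in> {1..M1} \<times> {1..M2}" "length h' = Suc i"
        using \<open>v \<in> states (Suc i)\<close> by (auto simp: states_def 1)
      obtain h z where 3: "h' = h @ [z]" "length h = i"
        using 2(2) by (metis length_Suc_conv_rev)
      show thesis by (rule that[of w h z]) (use 1 2(1) 3 in simp_all)
    qed
    have "((w, h), z) \<in> states i \<times> UNIV" using v(2,3) by (simp add: states_def)
    then have "{a \<in> states i \<times> UNIV. ?\<pi> a = v} = {((w, h), z)}"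
      unfolding v(1) by auto
    then show ?thesis unfolding marg_def by (simp only: sum.insert) (simp add: joint_def v(1) law_Suc)
  qed
  have "?\<pi> ` (states i \<times> UNIV) \<subseteq> states (Suc i)" by (auto simp: states_def)
  from ent_image[of "states i \<times> UNIV", OF _ finite_states this m, of f]
  show ?thesis by (simp only: case_prod_unfold finite_SigmaI finite_states finite_class.finite_UNIV)
qed

text \<open>With \<open>Z\<close> the block of all channel outputs and \<open>F\<close> the block of both feedback outputs up to time \<open>i\<close>:
  \<open>known1 i = - H(W1 | W2, Z)\<close>, \<open>known2 i = - H(W2 | W1, Z)\<close>, \<open>known_both i = - H(W1, W2 | Z)\<close>,
  \<open>dependence i = I(W1; W2 | F)\<close> and \<open>known_output i = - H(W1, W2 | Y)\<close>.\<close>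

definition known1 :: "nat \<Rightarrow> real" where
  "known1 i = ent (states i) (law i) (\<lambda>s. (snd (fst s), snd s))
    - ent (states i) (law i) (\<lambda>s. (fst (fst s), snd (fst s), snd s))"

definition known2 :: "nat \<Rightarrow> real" where
  "known2 i = ent (states i) (law i) (\<lambda>s. (fst (fst s), snd s))
    - ent (states i) (law i) (\<lambda>s. (fst (fst s), snd (fst s), snd s))"

definition known_both :: "nat \<Rightarrow> real" where
  "known_both i = ent (states i) (law i) snd - ent (states i) (law i) (\<lambda>s. (fst (fst s), snd (fst s), snd s))"

definition dependence :: "nat \<Rightarrow> real" where
  "dependence i = ent (states i) (law i) (\<lambda>s. (fst (fst s), past s)) + ent (states i) (law i) (\<lambda>s. (snd (fst s), past s))
    - ent (states i) (law i) past - ent (states i) (law i) (\<lambda>s. (fst (fst s), snd (fst s), past s))"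

definition known_output :: "nat \<Rightarrow> real" where
  "known_output i = ent (states i) (law i) (\<lambda>s. map fst (snd s)) - ent (states i) (law i) (\<lambda>s. (fst s, map fst (snd s)))"

lemma knowledge_Suc:
  defines "D \<equiv> \<lambda>i. {c :: ('f1 \<times> 'f2) list. length c = i}"
  shows "known1 (Suc i) - known1 i \<le> (\<Sum>c\<in>D i. rate1 (slice i c))"
    "known2 (Suc i) - known2 i \<le> (\<Sum>c\<in>D i. rate2 (slice i c))"
    "known_both (Suc i) - known_both i \<le> (\<Sum>c\<in>D i. sum_rate (slice i c))"
    "dependence (Suc i) - dependence i \<le> (\<Sum>c\<in>D i. balance (slice i c))"
    "known_output (Suc i) - known_output i \<le> output_rate (marg (states i) (law i) (input i))"
proof -
  have fin: "finite (states i)" "finite (D i)" "past ` states i \<subseteq> D i"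
    by (auto simp: D_def finite_states finite_lists_length past_def states_def)
  have x: "input i s = ((\<lambda>w c. e1 (Suc i) w (map fst c)) (fst (fst s)) (past s),
      (\<lambda>w c. e2 (Suc i) w (map snd c)) (snd (fst s)) (past s))" for s
    by (simp add: input_def)
  have sl: "slice i c = (\<lambda>v. marg (states i) (law i) (\<lambda>s. (input i s, past s)) (v, c))" for c
    by (simp add: slice_def fun_eq_iff)
  let ?E = "\<lambda>f. ent (states i \<times> UNIV) (joint (law i) (input i)) f"
  show "known1 (Suc i) - known1 i \<le> (\<Sum>c\<in>D i. rate1 (slice i c))"
  proof -
    \<comment> \<open>The list \<open>h @ [z]\<close> and the pair \<open>(h, z)\<close> induce the
      same partition, which is all that \<open>ent\<close> sees.\<close>
    have "ent (states (Suc i)) (law (Suc i)) (\<lambda>s. (snd (fst s), snd s)) = ?E (\<lambda>(s, z). (snd (fst s), snd s, z))"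
      "ent (states (Suc i)) (law (Suc i)) (\<lambda>s. (fst (fst s), snd (fst s), snd s))
        = ?E (\<lambda>(s, z). (fst (fst s), snd (fst s), snd s, z))"
      unfolding ent_Suc by (rule ent_cong; auto)+
    then show ?thesis
      using single_letter_rate1[of "states i" "D i" past "law i" "map snd" snd "input i" _ "\<lambda>s. fst (fst s)" _ "\<lambda>s. snd (fst s)",
          OF fin law_nonneg past_def x]
      unfolding known1_def sl by simp
  qed
  show "known2 (Suc i) - known2 i \<le> (\<Sum>c\<in>D i. rate2 (slice i c))"
  proof -
    have "ent (states (Suc i)) (law (Suc i)) (\<lambda>s. (fst (fst s), snd s)) = ?E (\<lambda>(s, z). (fst (fst s), snd s, z))"
      "ent (states (Suc i)) (law (Suc i)) (\<lambda>s. (fst (fst s), snd (fst s), snd s))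
        = ?E (\<lambda>(s, z). (fst (fst s), snd (fst s), snd s, z))"
      unfolding ent_Suc by (rule ent_cong; auto)+
    then show ?thesis
      using single_letter_rate2[of "states i" "D i" past "law i" "map snd" snd "input i" _ "\<lambda>s. fst (fst s)" _ "\<lambda>s. snd (fst s)",
          OF fin law_nonneg past_def x]
      unfolding known2_def sl by simp
  qed
  show "known_both (Suc i) - known_both i \<le> (\<Sum>c\<in>D i. sum_rate (slice i c))"
  proof -
    have "ent (states (Suc i)) (law (Suc i)) snd = ?E (\<lambda>(s, z). (snd s, z))"
      "ent (states (Suc i)) (law (Suc i)) (\<lambda>s. (fst (fst s), snd (fst s), snd s))
        = ?E (\<lambda>(s, z). (fst (fst s), snd (fst s), snd s, z))"
      unfolding ent_Suc by (rule ent_cong; auto)+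
    then show ?thesis
      using single_letter_sum_rate[of "states i" "D i" past "law i" "map snd" snd "input i" _ "\<lambda>s. fst (fst s)" _ "\<lambda>s. snd (fst s)",
          OF fin law_nonneg past_def x]
      unfolding known_both_def sl by simp
  qed
  show "dependence (Suc i) - dependence i \<le> (\<Sum>c\<in>D i. balance (slice i c))"
  proof -
    have "ent (states (Suc i)) (law (Suc i)) (\<lambda>s. (fst (fst s), past s))
        = ?E (\<lambda>(s, z). (fst (fst s), past s, snd z))"
      "ent (states (Suc i)) (law (Suc i)) (\<lambda>s. (snd (fst s), past s))
        = ?E (\<lambda>(s, z). (snd (fst s), past s, snd z))"
      "ent (states (Suc i)) (law (Suc i)) past = ?E (\<lambda>(s, z). (past s, snd z))"
      "ent (states (Suc i)) (law (Suc i)) (\<lambda>s. (fst (fst s), snd (fst s), past s))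
        = ?E (\<lambda>(s, z). (fst (fst s), snd (fst s), past s, snd z))"
      unfolding ent_Suc by (rule ent_cong; auto simp: past_def)+
    then show ?thesis
      using single_letter_balance[of "states i" "D i" past "law i" "input i" _ "\<lambda>s. fst (fst s)" _ "\<lambda>s. snd (fst s)",
          OF fin law_nonneg x]
      unfolding dependence_def sl by simp
  qed
  show "known_output (Suc i) - known_output i \<le> output_rate (marg (states i) (law i) (input i))"
  proof -
    have "ent (states (Suc i)) (law (Suc i)) (\<lambda>s. map fst (snd s)) = ?E (\<lambda>(s, z). (map fst (snd s), fst z))"
      "ent (states (Suc i)) (law (Suc i)) (\<lambda>s. (fst s, map fst (snd s)))
        = ?E (\<lambda>(s, z). (fst s, map fst (snd s), fst z))"
      unfolding ent_Suc by (rule ent_cong; auto)+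
    then show ?thesis
      using single_letter_output_rate[of "states i" "law i" "\<lambda>s. map fst (snd s)" "map fst" snd "input i" "\<lambda>w h. input i (w, h)" fst]
        fin law_nonneg
      unfolding known_output_def by simp
  qed
qed

section \<open>Block quantities before the first and after the last use\<close>

lemma ent_0:
  assumes "\<And>s. s \<in> states 0 \<Longrightarrow> real (card {s' \<in> states 0. f s' = f s}) = k"
  shows "ent (states 0) (law 0) f = - ln (k / (real M1 * real M2))"
proof -
  have "marg (states 0) (law 0) f (f s) = k / (real M1 * real M2)" if "s \<in> states 0" for s
  proof -
    have "marg (states 0) (law 0) f (f s) = (\<Sum>s'\<in>{s' \<in> states 0. f s' = f s}. 1 / (real M1 * real M2))"
      unfolding marg_def by (intro sum.cong) (auto simp: law_0)
    then show ?thesis using assms[OF that] by simp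
  qed
  then show ?thesis
    by (simp add: ent_def sum_distrib_right[symmetric] sum_law)
qed

text \<open>At time 0 the output list is empty, so \<open>g\<close> adds no information and only the
  number of message pairs in a level set counts.\<close>

lemma ent_0_values:
  "ent (states 0) (law 0) (\<lambda>s. (fst (fst s), g (snd s))) = ln M1"
  "ent (states 0) (law 0) (\<lambda>s. (snd (fst s), g (snd s))) = ln M2"
  "ent (states 0) (law 0) (\<lambda>s. (fst (fst s), snd (fst s), g (snd s))) = ln M1 + ln M2"
  "ent (states 0) (law 0) (\<lambda>s. (fst s, g (snd s))) = ln M1 + ln M2"
  "ent (states 0) (law 0) (\<lambda>s. g (snd s)) = 0"
proof -
  have "ent (states 0) (law 0) (\<lambda>s. (fst (fst s), g (snd s))) = - ln (real M2 / (real M1 * real M2))"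
  proof (rule ent_0)
    fix s assume "s \<in> states 0"
    then have "{s' \<in> states 0. (fst (fst s'), g (snd s')) = (fst (fst s), g (snd s))} = ({fst (fst s)} \<times> {1..M2}) \<times> {[]}"
      by (auto simp: states_def)
    then show "real (card {s' \<in> states 0. (fst (fst s'), g (snd s')) = (fst (fst s), g (snd s))}) = real M2"
      by (simp add: card_cartesian_product)
  qed
  then show "ent (states 0) (law 0) (\<lambda>s. (fst (fst s), g (snd s))) = ln M1"
    using M by (simp add: ln_div)
  have "ent (states 0) (law 0) (\<lambda>s. (snd (fst s), g (snd s))) = - ln (real M1 / (real M1 * real M2))"
  proof (rule ent_0)
    fix s assume "s \<in> states 0"
    then have "{s' \<in> states 0. (snd (fst s'), g (snd s')) = (snd (fst s), g (snd s))} = ({1..M1} \<times> {snd (fst s)}) \<times> {[]}"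
      by (auto simp: states_def)
    then show "real (card {s' \<in> states 0. (snd (fst s'), g (snd s')) = (snd (fst s), g (snd s))}) = real M1"
      by (simp add: card_cartesian_product)
  qed
  then show "ent (states 0) (law 0) (\<lambda>s. (snd (fst s), g (snd s))) = ln M2"
    using M by (simp add: ln_div)
  have "ent (states 0) (law 0) (\<lambda>s. (fst s, g (snd s))) = - ln (1 / (real M1 * real M2))"
  proof (rule ent_0)
    fix s assume "s \<in> states 0"
    then have "{s' \<in> states 0. (fst s', g (snd s')) = (fst s, g (snd s))} = {s}"
      by (cases s) (auto simp: states_def)
    then show "real (card {s' \<in> states 0. (fst s', g (snd s')) = (fst s, g (snd s))}) = 1"
      by simp
  qed
  then show *: "ent (states 0) (law 0) (\<lambda>s. (fst s, g (snd s))) = ln M1 + ln M2"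
    using M by (simp add: ln_div ln_mult)
  show "ent (states 0) (law 0) (\<lambda>s. (fst (fst s), snd (fst s), g (snd s))) = ln M1 + ln M2"
    unfolding *[symmetric] by (rule ent_cong) auto
  have "ent (states 0) (law 0) (\<lambda>s. g (snd s)) = - ln (real M1 * real M2 / (real M1 * real M2))"
  proof (rule ent_0)
    fix s assume "s \<in> states 0"
    then have "snd s = []" by (simp add: states_def mem_Times_iff)
    moreover have "snd s' = []" if "s' \<in> states 0" for s'
      using that by (simp add: states_def mem_Times_iff)
    ultimately have "{s' \<in> states 0. g (snd s') = g (snd s)} = states 0" by (simp cong: conj_cong)
    moreover have "states 0 = ({1..M1} \<times> {1..M2}) \<times> {[]}" by (simp add: states_def)
    ultimately show "real (card {s' \<in> states 0. g (snd s') = g (snd s)}) = real M1 * real M2"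
      by (simp only: card_cartesian_product) simp
  qed
  then show "ent (states 0) (law 0) (\<lambda>s. g (snd s)) = 0"
    using M by simp
qed

text \<open>Independence of the messages enters here: neither message tells anything about the
  other, so the dependence starts at 0.\<close>

lemma knowledge_0: "known1 0 = - ln M1" "known2 0 = - ln M2" "known_both 0 = - (ln M1 + ln M2)" "dependence 0 = 0"
    "known_output 0 = - (ln M1 + ln M2)"
  using ent_0_values[of "\<lambda>h. h"] ent_0_values[of "map snd"] ent_0_values[of "map fst"]
  unfolding known1_def known2_def known_both_def dependence_def known_output_def past_def by simp_all

text \<open>Fano's inequality with the decoder as the guess, since every condition contains the
  receiver outputs. The bound on \<open>dependence\<close> is nonnegativity of conditional mutual
  information.\<close>

lemma knowledge_final:
  assumes "error_prob W n M1 M2 e1 e2 g \<le> \<epsilon>"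
  shows "- (ln 2 + \<epsilon> * ln M1) \<le> known1 n" "- (ln 2 + \<epsilon> * ln M2) \<le> known2 n"
    "- (ln 2 + \<epsilon> * (ln M1 + ln M2)) \<le> known_both n" "0 \<le> dependence n"
    "- (ln 2 + \<epsilon> * (ln M1 + ln M2)) \<le> known_output n"
proof -
  let ?S = "states n" and ?p = "law n"
  note S = finite_states[of n] law_nonneg[of n]
  let ?B = "{s \<in> ?S. fst s \<noteq> g (map fst (snd s))}"
  have "error_prob W n M1 M2 e1 e2 g
      = measure_pmf.prob (code_law W n M1 M2 e1 e2) ({(w, h). g (map fst h) \<noteq> w} \<inter> set_pmf (code_law W n M1 M2 e1 e2))"
    by (simp add: error_prob_def measure_Int_set_pmf)
  also have "\<dots> = sum ?p ({(w, h). g (map fst h) \<noteq> w} \<inter> set_pmf (code_law W n M1 M2 e1 e2))"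
    unfolding law_def using finite_subset[OF set_pmf_code_law finite_states]
    by (intro measure_measure_pmf_finite) auto
  also have "\<dots> = sum ?p ?B"
    using set_pmf_code_law finite_states
    by (intro sum.mono_neutral_left) (auto simp: set_pmf_eq law_def)
  finally have err: "sum ?p ?B \<le> \<epsilon>" using assms by simp
  \<comment> \<open>An error in one message is an error in the pair.\<close>
  have sub: "sum ?p B \<le> \<epsilon>" if "B \<subseteq> ?B" for B
    using err sum_mono2[OF _ that, of ?p] S by simp
  have card: "card ((\<lambda>s. fst (fst s)) ` ?S) \<le> M1" "card ((\<lambda>s. snd (fst s)) ` ?S) \<le> M2" "card (fst ` ?S) \<le> M1 * M2"
    using card_mono[of "{1..M1}" "(\<lambda>s. fst (fst s)) ` ?S"] card_mono[of "{1..M2}" "(\<lambda>s. snd (fst s)) ` ?S"]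
      card_mono[of "{1..M1} \<times> {1..M2}" "fst ` ?S"]
    by (auto simp: states_def image_subset_iff card_cartesian_product)
  note fano = ent_fano[of ?S ?p, OF S sum_law]
  have "ent ?S ?p (\<lambda>s. (fst (fst s), (snd (fst s), snd s))) - ent ?S ?p (\<lambda>s. (snd (fst s), snd s)) \<le> ln 2 + \<epsilon> * ln M1"
    by (rule fano[OF card(1) M(1), where d = "\<lambda>(w, h). fst (g (map fst h))"], rule sub) (auto simp: prod_eq_iff)
  then show "- (ln 2 + \<epsilon> * ln M1) \<le> known1 n" unfolding known1_def by simp
  have "ent ?S ?p (\<lambda>s. (snd (fst s), (fst (fst s), snd s))) - ent ?S ?p (\<lambda>s. (fst (fst s), snd s)) \<le> ln 2 + \<epsilon> * ln M2"
    by (rule fano[OF card(2) M(2), where d = "\<lambda>(w, h). snd (g (map fst h))"], rule sub) (auto simp: prod_eq_iff)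
  moreover have "ent ?S ?p (\<lambda>s. (snd (fst s), (fst (fst s), snd s))) = ent ?S ?p (\<lambda>s. (fst (fst s), snd (fst s), snd s))"
    by (rule ent_cong) auto
  ultimately show "- (ln 2 + \<epsilon> * ln M2) \<le> known2 n" unfolding known2_def by simp
  have l: "ln (real (M1 * M2)) = ln M1 + ln M2" using M by (simp add: ln_mult)
  have "ent ?S ?p (\<lambda>s. (fst s, snd s)) - ent ?S ?p snd \<le> ln 2 + \<epsilon> * ln (real (M1 * M2))"
    by (rule fano[OF card(3), where d = "\<lambda>h. g (map fst h)"], use M in simp, rule sub) auto
  moreover have "ent ?S ?p (\<lambda>s. (fst s, snd s)) = ent ?S ?p (\<lambda>s. (fst (fst s), snd (fst s), snd s))"
    by (rule ent_cong) auto
  ultimately show "- (ln 2 + \<epsilon> * (ln M1 + ln M2)) \<le> known_both n" unfolding known_both_def l by simp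
  have "ent ?S ?p (\<lambda>s. (fst s, map fst (snd s))) - ent ?S ?p (\<lambda>s. map fst (snd s)) \<le> ln 2 + \<epsilon> * ln (real (M1 * M2))"
    by (rule fano[OF card(3), where d = g], use M in simp, rule sub) auto
  then show "- (ln 2 + \<epsilon> * (ln M1 + ln M2)) \<le> known_output n" unfolding known_output_def l by simp
  show "0 \<le> dependence n"
    using ent_submodular[of ?S ?p "\<lambda>s. fst (fst s)" "\<lambda>s. snd (fst s)" past, OF S] unfolding dependence_def by simp
qed

lemma code_family:
  assumes "error_prob W n M1 M2 e1 e2 g \<le> \<epsilon>"
  obtains I and q :: "nat \<times> ('f1 \<times> 'f2) list \<Rightarrow> 'x1 \<times> 'x2 \<Rightarrow> real"
  where "finite I" "\<And>t v. 0 \<le> q t v" "(\<Sum>t\<in>I. \<Sum>v\<in>UNIV. q t v) = n"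
    "(1 - \<epsilon>) * ln M1 - ln 2 \<le> (\<Sum>t\<in>I. rate1 (q t))"
    "(1 - \<epsilon>) * ln M2 - ln 2 \<le> (\<Sum>t\<in>I. rate2 (q t))"
    "(1 - \<epsilon>) * (ln M1 + ln M2) - ln 2 \<le> (\<Sum>t\<in>I. sum_rate (q t))"
    "0 \<le> (\<Sum>t\<in>I. balance (q t))"
    "(1 - \<epsilon>) * (ln M1 + ln M2) - ln 2 \<le> output_rate (\<lambda>v. \<Sum>t\<in>I. q t v)"
proof -
  define D where "D i = {c :: ('f1 \<times> 'f2) list. length c = i}" for i
  have finD: "finite (D i)" for i by (simp add: D_def finite_lists_length)
  \<comment> \<open>An index \<open>(i, c)\<close> is a value of T: the time, counted from 0, and
    the feedback seen before that use.\<close>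
  let ?I = "Sigma {..<n} D" and ?q = "\<lambda>(i, c). slice i c"
  have sumI: "(\<Sum>t\<in>?I. F (?q t)) = (\<Sum>i<n. \<Sum>c\<in>D i. F (slice i c))" for F :: "_ \<Rightarrow> real"
    using sum.Sigma[of "{..<n}" D "\<lambda>i c. F (slice i c)"] finD by (simp add: case_prod_unfold)
  have tel: "info n - info 0 \<le> (\<Sum>i<n. \<Phi> i)" if "\<And>i. info (Suc i) - info i \<le> \<Phi> i" for info \<Phi> :: "nat \<Rightarrow> real"
  proof -
    have "info n - info 0 = (\<Sum>i<n. info (Suc i) - info i)" by (simp only: sum_lessThan_telescope)
    also have "\<dots> \<le> (\<Sum>i<n. \<Phi> i)" by (intro sum_mono that)
    finally show ?thesis .
  qed
  note suc = knowledge_Suc[folded D_def]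
  note fano = knowledge_final[OF assms]
  have r1: "finite ?I" by (intro finite_SigmaI finD) simp
  have r2: "0 \<le> ?q t v" for t v
    by (cases t) (simp add: slice_def marg_nonneg law_nonneg)
  have r4: "(1 - \<epsilon>) * ln M1 - ln 2 \<le> (\<Sum>t\<in>?I. rate1 (?q t))"
    unfolding sumI using tel[of known1, OF suc(1)] fano(1) knowledge_0(1) by (simp add: left_diff_distrib)
  have r5: "(1 - \<epsilon>) * ln M2 - ln 2 \<le> (\<Sum>t\<in>?I. rate2 (?q t))"
    unfolding sumI using tel[of known2, OF suc(2)] fano(2) knowledge_0(2) by (simp add: left_diff_distrib)
  have r6: "(1 - \<epsilon>) * (ln M1 + ln M2) - ln 2 \<le> (\<Sum>t\<in>?I. sum_rate (?q t))"
    unfolding sumI using tel[of known_both, OF suc(3)] fano(3) knowledge_0(3) by (simp add: left_diff_distrib)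
  have r7: "0 \<le> (\<Sum>t\<in>?I. balance (?q t))"
    unfolding sumI using tel[of dependence, OF suc(4)] fano(4) knowledge_0(4) by (simp add: left_diff_distrib)
  have past: "past ` states i \<subseteq> D i" for i by (auto simp: past_def states_def D_def)
  \<comment> \<open>Forgetting the feedback leaves the input law at one time, of mass 1; hence the
    total mass \<open>n\<close>.\<close>
  have sum_slice: "(\<Sum>c\<in>D i. slice i c v) = marg (states i) (law i) (input i) v" for i v
  proof -
    have "(\<Sum>c\<in>D i. slice i c v)
        = (\<Sum>c\<in>D i. \<Sum>s\<in>{s \<in> {s \<in> states i. input i s = v}. past s = c}. law i s)"
      unfolding slice_def marg_def by (intro sum.cong) auto
    also have "\<dots> = (\<Sum>s\<in>{s \<in> states i. input i s = v}. law i s)"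
      using past[of i] finD by (intro sum.group) (auto simp: finite_states)
    finally show ?thesis by (simp add: marg_def)
  qed
  have "(\<Sum>t\<in>?I. \<Sum>v\<in>UNIV. ?q t v) = (\<Sum>i<n. \<Sum>c\<in>D i. \<Sum>v\<in>UNIV. slice i c v)"
    using sumI[of "\<lambda>u. \<Sum>v\<in>UNIV. u v"] by simp
  also have "\<dots> = (\<Sum>i<n. \<Sum>v\<in>UNIV. marg (states i) (law i) (input i) v)"
    by (subst sum.swap) (simp add: sum_slice)
  also have "\<dots> = n"
    by (simp add: sum_marg_eq[OF finite_states] sum_law)
  finally have r3: "(\<Sum>t\<in>?I. \<Sum>v\<in>UNIV. ?q t v) = n" .
  have "known_output n - known_output 0 \<le> (\<Sum>i<n. output_rate (marg (states i) (law i) (input i)))"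
    by (rule tel) (rule suc(5))
  also have "\<dots> \<le> output_rate (\<lambda>v. \<Sum>i<n. marg (states i) (law i) (input i) v)"
    by (rule output_rate_superadditive) (auto intro: marg_nonneg law_nonneg)
  also have "(\<lambda>v. \<Sum>i<n. marg (states i) (law i) (input i) v) = (\<lambda>v. \<Sum>t\<in>?I. ?q t v)"
    using sumI[of "\<lambda>u. u _"] by (simp add: sum_slice)
  finally have r8: "(1 - \<epsilon>) * (ln M1 + ln M2) - ln 2 \<le> output_rate (\<lambda>v. \<Sum>t\<in>?I. ?q t v)"
    using fano(5) knowledge_0(5) by (simp add: left_diff_distrib)
  show thesis
    by (rule that[OF r1 r2 r3 r4 r5 r6 r7 r8])
qed

end

subsection \<open>Bounding the time-sharing alphabet\<close>

text \<open>Linear dependence of the image set covers only families without repetition; two equal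
  members give a relation by their difference.\<close>

lemma linear_relation_on_family:
  fixes f :: "'i \<Rightarrow> 'e::euclidean_space"
  assumes fin: "finite I" and card: "DIM('e) < card I"
  obtains \<mu> where "(\<Sum>t\<in>I. \<mu> t *\<^sub>R f t) = 0" "\<exists>t\<in>I. \<mu> t \<noteq> (0::real)"
proof (cases "inj_on f I")
  case True
  have "dependent (f ` I)"
    using fin card by (intro dependent_biggerset) (auto simp: card_image[OF True])
  then obtain u where u: "\<exists>v\<in>f ` I. u v \<noteq> 0" "(\<Sum>v\<in>f ` I. u v *\<^sub>R v) = 0"
    using fin by (auto simp: dependent_finite)
  then show thesis
    by (intro that[of "\<lambda>t. u (f t)"]) (auto simp: sum.reindex[OF True])
next
  case False
  then obtain s t where st: "s \<in> I" "t \<in> I" "f s = f t" "s \<noteq> t" by (auto simp: inj_on_def)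
  define \<mu> :: "'i \<Rightarrow> real" where "\<mu> r = of_bool (r = s) - of_bool (r = t)" for r
  have "(\<Sum>r\<in>I. \<mu> r *\<^sub>R f r) = (\<Sum>r\<in>I. if r = s then f r else 0) - (\<Sum>r\<in>I. if r = t then f r else 0)"
    unfolding sum_subtractf[symmetric] by (intro sum.cong) (auto simp: \<mu>_def)
  also have "\<dots> = 0" using st fin by simp
  finally show thesis using st by (intro that[of \<mu>]) (auto simp: \<mu>_def)
qed

text \<open>A basic optimal solution of the linear program that maximises \<open>c\<close> subject to the equations given by \<open>f\<close>.
  The positive functional \<open>m\<close> makes the program bounded.\<close>

lemma support_reduction:
  fixes f :: "'i \<Rightarrow> 'e::euclidean_space" and c l :: "'i \<Rightarrow> real"
  assumes "finite I" "\<And>t. t \<in> I \<Longrightarrow> 0 \<le> l t" "linear m" "\<And>t. t \<in> I \<Longrightarrow> 0 < (m (f t) :: real)"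
  shows "\<exists>J l'. J \<subseteq> I \<and> card J \<le> DIM('e) \<and> (\<forall>t\<in>J. 0 \<le> l' t)
    \<and> (\<Sum>t\<in>J. l' t *\<^sub>R f t) = (\<Sum>t\<in>I. l t *\<^sub>R f t) \<and> (\<Sum>t\<in>I. l t * c t) \<le> (\<Sum>t\<in>J. l' t * c t)"
  using assms
proof (induction "card I" arbitrary: I l rule: less_induct)
  case less
  note I = \<open>finite I\<close> and l = less.prems(2) and pos = less.prems(4)
  show ?case
  proof (cases "card I \<le> DIM('e)")
    case True
    then show ?thesis using l by (intro exI[of _ I] exI[of _ l]) auto
  next
    case False
    then have "DIM('e) < card I" by simp
    then obtain \<mu>0 where \<mu>0: "(\<Sum>t\<in>I. \<mu>0 t *\<^sub>R f t) = 0" "\<exists>t\<in>I. \<mu>0 t \<noteq> 0"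
      by (rule linear_relation_on_family[OF I])
    \<comment> \<open>The relation may be negated, so it is oriented not to decrease the
      objective.\<close>
    define \<sigma> :: real where "\<sigma> = (if 0 \<le> (\<Sum>t\<in>I. \<mu>0 t * c t) then 1 else - 1)"
    define \<mu> where "\<mu> t = \<sigma> * \<mu>0 t" for t
    have "(\<Sum>t\<in>I. \<mu> t *\<^sub>R f t) = \<sigma> *\<^sub>R (\<Sum>t\<in>I. \<mu>0 t *\<^sub>R f t)"
      by (simp add: \<mu>_def scaleR_sum_right)
    moreover have "(\<Sum>t\<in>I. \<mu> t * c t) = \<sigma> * (\<Sum>t\<in>I. \<mu>0 t * c t)"
      by (simp add: \<mu>_def sum_distrib_left mult.assoc)
    ultimately have \<mu>: "(\<Sum>t\<in>I. \<mu> t *\<^sub>R f t) = 0" "\<exists>t\<in>I. \<mu> t \<noteq> 0" "0 \<le> (\<Sum>t\<in>I. \<mu> t * c t)"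
      using \<mu>0 by (auto simp: \<mu>_def \<sigma>_def)
    \<comment> \<open>\<open>m\<close> sends the relation to 0 and is positive on every
      \<open>f t\<close>, so the coefficients cannot all be nonnegative.\<close>
    have "\<exists>t\<in>I. \<mu> t < 0"
    proof (rule ccontr)
      assume "\<not> (\<exists>t\<in>I. \<mu> t < 0)"
      then have nn: "0 \<le> \<mu> t" if "t \<in> I" for t using that by (auto simp: not_less)
      have "(\<Sum>t\<in>I. \<mu> t * m (f t)) = m (\<Sum>t\<in>I. \<mu> t *\<^sub>R f t)"
        using \<open>linear m\<close> by (simp add: linear_sum linear_scale)
      also have "\<dots> = 0" using \<mu>(1) \<open>linear m\<close> by (simp add: linear_0)
      finally have 0: "(\<Sum>t\<in>I. \<mu> t * m (f t)) = 0" .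
      have "0 \<le> \<mu> t * m (f t)" if "t \<in> I" for t
        using nn[OF that] pos[OF that] by simp
      then have "\<forall>t\<in>I. \<mu> t * m (f t) = 0"
        using 0 I by (simp add: sum_nonneg_eq_0_iff)
      then have "\<mu> t = 0" if "t \<in> I" for t using that pos[OF that] by auto
      then show False using \<mu>(2) by blast
    qed
    then obtain t0 where "is_arg_min (\<lambda>t. l t / - \<mu> t) (\<lambda>t. t \<in> {t \<in> I. \<mu> t < 0}) t0"
      using ex_is_arg_min_if_finite[of "{t \<in> I. \<mu> t < 0}" "\<lambda>t. l t / - \<mu> t"] I by auto
    then have t0: "t0 \<in> I" "\<mu> t0 < 0"
      and min: "\<And>t. t \<in> I \<Longrightarrow> \<mu> t < 0 \<Longrightarrow> l t0 / - \<mu> t0 \<le> l t / - \<mu> t"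
      unfolding is_arg_min_def mem_Collect_eq by (blast intro: leI)+
    \<comment> \<open>The largest step along \<open>\<mu>\<close> that keeps all weights
      nonnegative; it empties \<open>t0\<close>.\<close>
    define s where "s = l t0 / - \<mu> t0"
    have s: "0 \<le> s" using l[OF t0(1)] t0(2) by (simp add: s_def divide_nonneg_neg)
    define k where "k t = l t + s * \<mu> t" for t
    have k0: "k t0 = 0" using t0 by (simp add: k_def s_def)
    have k: "0 \<le> k t" if "t \<in> I" for t
    proof (cases "\<mu> t < 0")
      case True
      have "s \<le> l t / - \<mu> t" unfolding s_def by (rule min[OF that True])
      moreover have "0 < - \<mu> t" using True by simp
      ultimately have "s * - \<mu> t \<le> l t" by (simp only: pos_le_divide_eq)
      then show ?thesis by (simp add: k_def)
    qed (use s l[OF that] in \<open>simp add: k_def\<close>)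
    have rm: "(\<Sum>t\<in>I - {t0}. k t *\<^sub>R f t) = (\<Sum>t\<in>I. l t *\<^sub>R f t)"
    proof -
      have "(\<Sum>t\<in>I - {t0}. k t *\<^sub>R f t) = (\<Sum>t\<in>I. k t *\<^sub>R f t)"
        using I k0 by (intro sum.mono_neutral_left) auto
      also have "\<dots> = (\<Sum>t\<in>I. l t *\<^sub>R f t) + s *\<^sub>R (\<Sum>t\<in>I. \<mu> t *\<^sub>R f t)"
        by (simp add: k_def scaleR_left_distrib sum.distrib scaleR_sum_right)
      finally show ?thesis using \<mu>(1) by simp
    qed
    have rc: "(\<Sum>t\<in>I. l t * c t) \<le> (\<Sum>t\<in>I - {t0}. k t * c t)"
    proof -
      have "(\<Sum>t\<in>I - {t0}. k t * c t) = (\<Sum>t\<in>I. k t * c t)"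
        using I k0 by (intro sum.mono_neutral_left) auto
      also have "\<dots> = (\<Sum>t\<in>I. l t * c t) + s * (\<Sum>t\<in>I. \<mu> t * c t)"
        by (simp add: k_def distrib_right sum.distrib sum_distrib_left mult.assoc)
      finally show ?thesis using \<mu>(3) s by simp
    qed
    have "card (I - {t0}) < card I" by (rule card_Diff1_less[OF I t0(1)])
    then have "\<exists>J l'. J \<subseteq> I - {t0} \<and> card J \<le> DIM('e) \<and> (\<forall>t\<in>J. 0 \<le> l' t)
      \<and> (\<Sum>t\<in>J. l' t *\<^sub>R f t) = (\<Sum>t\<in>I - {t0}. k t *\<^sub>R f t)
      \<and> (\<Sum>t\<in>I - {t0}. k t * c t) \<le> (\<Sum>t\<in>J. l' t * c t)"
      by (rule less.hyps) (use I k pos \<open>linear m\<close> in simp_all)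
    then obtain J l' where "J \<subseteq> I - {t0}" "card J \<le> DIM('e)" "\<forall>t\<in>J. 0 \<le> l' t"
      "(\<Sum>t\<in>J. l' t *\<^sub>R f t) = (\<Sum>t\<in>I - {t0}. k t *\<^sub>R f t)"
      "(\<Sum>t\<in>I - {t0}. k t * c t) \<le> (\<Sum>t\<in>J. l' t * c t)"
      by blast
    then show ?thesis using rm rc by (intro exI[of _ J] exI[of _ l']) auto
  qed
qed

section \<open>Feasible families of slices\<close>

context separable_mac
begin

lemma functionals_zero: "rate1 (\<lambda>_. 0) = 0" "rate2 (\<lambda>_. 0) = 0" "sum_rate (\<lambda>_. 0) = 0" "balance (\<lambda>_. 0) = 0"
  using functionals_scale[of 0 "\<lambda>_. 0"] by simp_all

text \<open>The conditions of the region in natural logarithms. \<open>r\<close> stands for R1 + R2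
  and is separate so that every rate bound can lose the same slack.\<close>

definition feasible :: "(nat \<Rightarrow> 'x1 \<times> 'x2 \<Rightarrow> real) \<Rightarrow> real \<Rightarrow> real \<Rightarrow> real \<Rightarrow> bool" where
  "feasible q r1 r2 r \<longleftrightarrow>
    (\<forall>t v. 0 \<le> q t v) \<and> (\<Sum>t<CARD('x1) * CARD('x2) + 3. \<Sum>v\<in>UNIV. q t v) = 1 \<and>
    r1 \<le> (\<Sum>t<CARD('x1) * CARD('x2) + 3. rate1 (q t)) \<and>
    r2 \<le> (\<Sum>t<CARD('x1) * CARD('x2) + 3. rate2 (q t)) \<and>
    r \<le> (\<Sum>t<CARD('x1) * CARD('x2) + 3. sum_rate (q t)) \<and>
    0 \<le> (\<Sum>t<CARD('x1) * CARD('x2) + 3. balance (q t)) \<and>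
    r \<le> output_rate (\<lambda>v. \<Sum>t<CARD('x1) * CARD('x2) + 3. q t v)"

text \<open>The equations preserve the law of (X1, X2), hence the total mass and
  \<open>output_rate\<close>, together with the three informations; the objective lets
  \<open>balance\<close> only rise.\<close>

lemma feasible_of_family:
  fixes q :: "'i \<Rightarrow> 'x1 \<times> 'x2 \<Rightarrow> real"
  assumes I: "finite I" and q: "\<And>t v. 0 \<le> q t v" and one: "(\<Sum>t\<in>I. \<Sum>v\<in>UNIV. q t v) = 1"
    and r: "r1 \<le> (\<Sum>t\<in>I. rate1 (q t))" "r2 \<le> (\<Sum>t\<in>I. rate2 (q t))" "r \<le> (\<Sum>t\<in>I. sum_rate (q t))"
      "0 \<le> (\<Sum>t\<in>I. balance (q t))" "r \<le> output_rate (\<lambda>v. \<Sum>t\<in>I. q t v)"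
  shows "\<exists>q'. feasible q' r1 r2 r"
proof -
  let ?L = "CARD('x1) * CARD('x2) + 3"
  \<comment> \<open>Zero slices are removed because the mass functional \<open>m\<close> must be
    positive on every member.\<close>
  define I' where "I' = {t \<in> I. q t \<noteq> (\<lambda>_. 0)}"
  have I': "finite I'" using I by (simp add: I'_def)
  have sum': "(\<Sum>t\<in>I. F (q t)) = (\<Sum>t\<in>I'. F (q t))" if "F (\<lambda>_. 0) = 0" for F :: "_ \<Rightarrow> real"
    using I that by (intro sum.mono_neutral_right) (auto simp: I'_def)
  \<comment> \<open>One coordinate per input pair and three for the informations: the dimension is
    the cardinality bound.\<close>
  define f :: "'i \<Rightarrow> (real ^ ('x1 \<times> 'x2)) \<times> real \<times> real \<times> real"
    where "f t = (\<chi> v. q t v, rate1 (q t), rate2 (q t), sum_rate (q t))" for t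
  define m where "m e = (\<Sum>v\<in>UNIV. fst e $ v)" for e :: "(real ^ ('x1 \<times> 'x2)) \<times> real \<times> real \<times> real"
  have "linear m"
    by (rule linearI) (auto simp: m_def sum.distrib sum_distrib_left)
  moreover have "0 < m (f t)" if "t \<in> I'" for t
  proof -
    have "\<exists>v. q t v \<noteq> 0" using that unfolding I'_def fun_eq_iff by blast
    then obtain v where "q t v \<noteq> 0" by blast
    then have "0 < q t v" using q[of t v] by simp
    then show ?thesis
      using q by (auto simp: m_def f_def intro!: sum_pos2[of _ v])
  qed
  ultimately have "\<exists>J l. J \<subseteq> I' \<and> card J \<le> DIM((real ^ ('x1 \<times> 'x2)) \<times> real \<times> real \<times> real) \<and> (\<forall>t\<in>J. 0 \<le> l t)
    \<and> (\<Sum>t\<in>J. l t *\<^sub>R f t) = (\<Sum>t\<in>I'. 1 *\<^sub>R f t)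
    \<and> (\<Sum>t\<in>I'. 1 * balance (q t)) \<le> (\<Sum>t\<in>J. l t * balance (q t))"
    by (intro support_reduction[OF I', where m = m]) simp_all
  then obtain J l where J: "J \<subseteq> I'" "card J \<le> DIM((real ^ ('x1 \<times> 'x2)) \<times> real \<times> real \<times> real)"
    and l: "\<And>t. t \<in> J \<Longrightarrow> 0 \<le> l t"
    and eq: "(\<Sum>t\<in>J. l t *\<^sub>R f t) = (\<Sum>t\<in>I'. 1 *\<^sub>R f t)"
    and le: "(\<Sum>t\<in>I'. 1 * balance (q t)) \<le> (\<Sum>t\<in>J. l t * balance (q t))"
    by blast
  have "DIM((real ^ ('x1 \<times> 'x2)) \<times> real \<times> real \<times> real) = ?L" by simp
  then have cJ: "card J \<le> ?L" using J(2) by simp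
  have finJ: "finite J" using J I' finite_subset by blast
  have eqv: "(\<Sum>t\<in>J. l t * q t v) = (\<Sum>t\<in>I'. q t v)" for v
    using arg_cong[OF eq, of "\<lambda>e. fst e $ v"] by (simp add: f_def fst_sum)
  have eq1: "(\<Sum>t\<in>J. l t * rate1 (q t)) = (\<Sum>t\<in>I'. rate1 (q t))"
    and eq2: "(\<Sum>t\<in>J. l t * rate2 (q t)) = (\<Sum>t\<in>I'. rate2 (q t))"
    and eq3: "(\<Sum>t\<in>J. l t * sum_rate (q t)) = (\<Sum>t\<in>I'. sum_rate (q t))"
    using arg_cong[OF eq, of "\<lambda>e. fst (snd e)"] arg_cong[OF eq, of "\<lambda>e. fst (snd (snd e))"]
      arg_cong[OF eq, of "\<lambda>e. snd (snd (snd e))"]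
    by (simp_all add: f_def fst_sum snd_sum)
  obtain h where h: "bij_betw h {0..<card J} J" using ex_bij_betw_nat_finite[OF finJ] by blast
  \<comment> \<open>The surviving slices are renumbered and padded with zero slices, on which the
    summed functionals vanish.\<close>
  define q' where "q' t = (if t < card J then (\<lambda>v. l (h t) * q (h t) v) else (\<lambda>_. 0))" for t
  have hJ: "h t \<in> J" if "t < card J" for t using h that by (auto simp: bij_betw_def)
  have sum: "(\<Sum>t<?L. F (q' t)) = (\<Sum>t\<in>J. F (\<lambda>v. l t * q t v))" if "F (\<lambda>_. 0) = 0" for F :: "_ \<Rightarrow> real"
  proof -
    have "(\<Sum>t<?L. F (q' t)) = (\<Sum>t\<in>{0..<card J}. F (q' t))"
      using cJ that by (intro sum.mono_neutral_right) (auto simp: q'_def)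
    also have "\<dots> = (\<Sum>t\<in>{0..<card J}. F (\<lambda>v. l (h t) * q (h t) v))"
      by (intro sum.cong) (auto simp: q'_def)
    also have "\<dots> = (\<Sum>t\<in>J. F (\<lambda>v. l t * q t v))"
      by (rule sum.reindex_bij_betw[OF h])
    finally show ?thesis .
  qed
  have tot: "(\<Sum>t<?L. q' t v) = (\<Sum>t\<in>I. q t v)" for v
    using sum[of "\<lambda>u. u v"] sum'[of "\<lambda>u. u v"] eqv[of v] by simp
  have sc: "(\<Sum>t\<in>J. rate1 (\<lambda>v. l t * q t v)) = (\<Sum>t\<in>J. l t * rate1 (q t))"
    "(\<Sum>t\<in>J. rate2 (\<lambda>v. l t * q t v)) = (\<Sum>t\<in>J. l t * rate2 (q t))"
    "(\<Sum>t\<in>J. sum_rate (\<lambda>v. l t * q t v)) = (\<Sum>t\<in>J. l t * sum_rate (q t))"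
    "(\<Sum>t\<in>J. balance (\<lambda>v. l t * q t v)) = (\<Sum>t\<in>J. l t * balance (q t))"
    by (intro sum.cong refl functionals_scale l q; assumption)+
  note red = sum[of rate1, OF functionals_zero(1)] sum[of rate2, OF functionals_zero(2)] sum[of sum_rate, OF functionals_zero(3)]
    sum[of balance, OF functionals_zero(4)]
  note red' = sum'[of rate1, OF functionals_zero(1)] sum'[of rate2, OF functionals_zero(2)] sum'[of sum_rate, OF functionals_zero(3)]
    sum'[of balance, OF functionals_zero(4)]
  have "feasible q' r1 r2 r"
    unfolding feasible_def
  proof (intro conjI)
    show "\<forall>t v. 0 \<le> q' t v" using q l hJ by (simp add: q'_def)
    have "(\<Sum>t<?L. \<Sum>v\<in>UNIV. q' t v) = (\<Sum>v\<in>UNIV. \<Sum>t<?L. q' t v)" by (rule sum.swap)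
    also have "\<dots> = (\<Sum>t\<in>I. \<Sum>v\<in>UNIV. q t v)" unfolding tot by (rule sum.swap)
    finally show "(\<Sum>t<?L. \<Sum>v\<in>UNIV. q' t v) = 1" using one by simp
    show "r1 \<le> (\<Sum>t<?L. rate1 (q' t))"
      unfolding red sc eq1 using r(1) unfolding red' .
    show "r2 \<le> (\<Sum>t<?L. rate2 (q' t))"
      unfolding red sc eq2 using r(2) unfolding red' .
    show "r \<le> (\<Sum>t<?L. sum_rate (q' t))"
      unfolding red sc eq3 using r(3) unfolding red' .
    show "0 \<le> (\<Sum>t<?L. balance (q' t))"
      unfolding red sc using r(4) le unfolding red' by simp
    show "r \<le> output_rate (\<lambda>v. \<Sum>t<?L. q' t v)" using r(5) by (simp add: tot)
  qed
  then show ?thesis by blast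
qed

text \<open>The entries lie in [0, 1] and the number of slices is fixed, so a subsequence converges
  entrywise; the functionals are continuous and the constraints closed.\<close>

lemma feasible_closed:
  assumes "\<And>\<delta>. 0 < \<delta> \<Longrightarrow> \<exists>q. feasible q (r1 - \<delta>) (r2 - \<delta>) (r - \<delta>)"
  shows "\<exists>q. feasible q r1 r2 r"
proof -
  let ?L = "CARD('x1) * CARD('x2) + 3"
  define \<delta> where "\<delta> n = inverse (real (Suc n))" for n
  have "\<exists>q. feasible q (r1 - \<delta> n) (r2 - \<delta> n) (r - \<delta> n)" for n
    by (rule assms) (simp add: \<delta>_def)
  then obtain Q where Q: "\<And>n. feasible (Q n) (r1 - \<delta> n) (r2 - \<delta> n) (r - \<delta> n)" by metis
  have nn: "0 \<le> Q n t v" for n t v using Q[of n] unfolding feasible_def by blast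
  have le: "Q n t v \<le> 1" if "t < ?L" for n t v
  proof -
    have "Q n t v \<le> (\<Sum>v\<in>UNIV. Q n t v)" using nn by (intro member_le_sum) auto
    also have "\<dots> \<le> (\<Sum>t<?L. \<Sum>v\<in>UNIV. Q n t v)"
      using nn that by (intro member_le_sum sum_nonneg) auto
    finally show ?thesis using Q[of n] by (simp add: feasible_def)
  qed
  have bound: "norm (Q n (fst p) (snd p)) \<le> 1" if "p \<in> {..<?L} \<times> (UNIV :: ('x1 \<times> 'x2) set)" for n p
    using nn le that by (auto simp del: split_paired_All)
  obtain k where k: "strict_mono k"
    and conv: "\<And>p. p \<in> {..<?L} \<times> UNIV \<Longrightarrow> \<exists>l. (\<lambda>n. Q (k n) (fst p) (snd p)) \<longlonglongrightarrow> l"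
    by (rule function_convergent_subsequence[of "{..<?L} \<times> (UNIV :: ('x1 \<times> 'x2) set)"
          "\<lambda>n p. Q n (fst p) (snd p)" 1, OF countable_finite bound]) simp_all
  have "\<exists>l. (\<lambda>n. Q (k n) t v) \<longlonglongrightarrow> l" if "t < ?L" for t v
    using conv[of "(t, v)"] that by simp
  then obtain l where l: "\<And>t v. t < ?L \<Longrightarrow> (\<lambda>n. Q (k n) t v) \<longlonglongrightarrow> l t v" by metis
  \<comment> \<open>Convergence is known only within the alphabet of T; the other entries are set to
    0.\<close>
  define q where "q t v = (if t < ?L then l t v else 0)" for t v
  have q: "(\<lambda>n. Q (k n) t v) \<longlonglongrightarrow> q t v" if "t < ?L" for t v
    using l[OF that] that by (simp add: q_def)
  have \<delta>0: "(\<lambda>n. \<delta> (k n)) \<longlonglongrightarrow> 0"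
    unfolding \<delta>_def using LIMSEQ_subseq_LIMSEQ[OF LIMSEQ_inverse_real_of_nat k] by (simp only: comp_def)
  have R: "(\<lambda>n. a - \<delta> (k n)) \<longlonglongrightarrow> a" for a
    using tendsto_diff[OF tendsto_const[of a] \<delta>0] by simp
  have ph: "(\<lambda>n. \<Sum>t<?L. rate1 (Q (k n) t)) \<longlonglongrightarrow> (\<Sum>t<?L. rate1 (q t))"
    "(\<lambda>n. \<Sum>t<?L. rate2 (Q (k n) t)) \<longlonglongrightarrow> (\<Sum>t<?L. rate2 (q t))"
    "(\<lambda>n. \<Sum>t<?L. sum_rate (Q (k n) t)) \<longlonglongrightarrow> (\<Sum>t<?L. sum_rate (q t))"
    "(\<lambda>n. \<Sum>t<?L. balance (Q (k n) t)) \<longlonglongrightarrow> (\<Sum>t<?L. balance (q t))"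
    by (intro tendsto_sum tendsto_functionals q nn; simp)+
  have ph5: "(\<lambda>n. output_rate (\<lambda>v. \<Sum>t<?L. Q (k n) t v)) \<longlonglongrightarrow> output_rate (\<lambda>v. \<Sum>t<?L. q t v)"
    using nn by (intro tendsto_functionals(5) tendsto_sum q sum_nonneg) auto
  have one: "(\<lambda>n. \<Sum>t<?L. \<Sum>v\<in>UNIV. Q (k n) t v) \<longlonglongrightarrow> (\<Sum>t<?L. \<Sum>v\<in>UNIV. q t v)"
    by (intro tendsto_sum q) auto
  have F: "(\<Sum>t<?L. \<Sum>v\<in>UNIV. Q n t v) = 1" "r1 - \<delta> n \<le> (\<Sum>t<?L. rate1 (Q n t))"
    "r2 - \<delta> n \<le> (\<Sum>t<?L. rate2 (Q n t))" "r - \<delta> n \<le> (\<Sum>t<?L. sum_rate (Q n t))"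
    "0 \<le> (\<Sum>t<?L. balance (Q n t))" "r - \<delta> n \<le> output_rate (\<lambda>v. \<Sum>t<?L. Q n t v)" for n
    using Q[of n] by (auto simp: feasible_def)
  have "feasible q r1 r2 r"
    unfolding feasible_def
  proof (intro conjI allI)
    show "0 \<le> q t v" for t v
      using LIMSEQ_le_const[OF q[of t v], of 0] nn by (cases "t < ?L") (auto simp: q_def)
    show "(\<Sum>t<?L. \<Sum>v\<in>UNIV. q t v) = 1"
      using one unfolding F(1) by (simp add: LIMSEQ_const_iff)
    show "r1 \<le> (\<Sum>t<?L. rate1 (q t))" by (rule LIMSEQ_le[OF R ph(1)]) (auto intro: F)
    show "r2 \<le> (\<Sum>t<?L. rate2 (q t))" by (rule LIMSEQ_le[OF R ph(2)]) (auto intro: F)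
    show "r \<le> (\<Sum>t<?L. sum_rate (q t))" by (rule LIMSEQ_le[OF R ph(3)]) (auto intro: F)
    show "0 \<le> (\<Sum>t<?L. balance (q t))" by (rule LIMSEQ_le_const[OF ph(4)]) (auto intro: F)
    show "r \<le> output_rate (\<lambda>v. \<Sum>t<?L. q t v)" by (rule LIMSEQ_le[OF R ph5]) (auto intro: F)
  qed
  then show ?thesis by blast
qed

end

subsection \<open>The outer bound\<close>

lemma pmf_embed_pmf_finite:
  fixes f :: "'a \<Rightarrow> real"
  assumes "finite A" "\<And>a. 0 \<le> f a" "\<And>a. a \<notin> A \<Longrightarrow> f a = 0" "(\<Sum>a\<in>A. f a) = 1"
  shows "pmf (embed_pmf f) a = f a"
proof (rule pmf_embed_pmf)
  have "(\<integral>\<^sup>+ x. ennreal (f x) \<partial>count_space UNIV) = (\<Sum>a\<in>A. ennreal (f a))"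
    using assms by (intro nn_integral_count_space') auto
  also have "\<dots> = 1" using assms by (simp add: sum_ennreal)
  finally show "(\<integral>\<^sup>+ x. ennreal (f x) \<partial>count_space UNIV) = 1" .
qed (rule assms)

section \<open>From codes to membership in the region\<close>

context separable_mac
begin

lemma DB_region_of_feasible:
  fixes W :: "('x1, 'x2, 'y, 'f1, 'f2) mac_gf"
  assumes b: "1 < b" and W: "\<And>x1 x2 z. pmf (W x1 x2) z = chan (x1, x2) z"
    and R: "0 \<le> R1" "0 \<le> R2" and q: "feasible q (R1 * ln b) (R2 * ln b) ((R1 + R2) * ln b)"
  shows "(R1, R2) \<in> DB_region b V V1 V2"
proof -
  define L where "L = CARD('x1) * CARD('x2) + 3"
  note F = q[unfolded feasible_def, folded L_def]
  have nn: "0 \<le> q t v" for t v using F by blast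
  have one: "(\<Sum>t<L. \<Sum>v\<in>UNIV. q t v) = 1" using F by blast
  define Q where "Q = embed_pmf (\<lambda>(t, v). if t < L then q t v else 0)"
  have pmf_Q: "pmf Q (t, v) = (if t < L then q t v else 0)" for t v
  proof -
    have "(\<Sum>a\<in>{..<L} \<times> UNIV. (\<lambda>(t, v). if t < L then q t v else 0) a) = (\<Sum>t<L. \<Sum>v\<in>UNIV. q t v)"
      by (subst sum.cartesian_product) (intro sum.cong; auto)
    then show ?thesis
      unfolding Q_def using nn one
      by (subst pmf_embed_pmf_finite[where A = "{..<L} \<times> UNIV"]) (auto split: if_splits)
  qed
  \<comment> \<open>Inputs drawn from \<open>Q\<close> are sent through the channel, which ignores
    \<open>t\<close>; this gives the required factorisation.\<close>
  define P :: "(nat \<times> 'x1 \<times> 'x2 \<times> 'y \<times> 'f1 \<times> 'f2) pmf"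
    where "P = bind_pmf Q (\<lambda>a. map_pmf (\<lambda>z. (fst a, fst (snd a), snd (snd a), z)) (W (fst (snd a)) (snd (snd a))))"
  have pmf_P: "pmf P (t, x1, x2, z) = pmf Q (t, x1, x2) * chan (x1, x2) z" for t x1 x2 z
    using pmf_bind_map_pmf[of "\<lambda>a z. (fst a, fst (snd a), snd (snd a), z)" Q
        "\<lambda>a. W (fst (snd a)) (snd (snd a))" "(t, x1, x2)" z]
    by (auto simp: P_def W)
  define A where "A = {..<L} \<times> (UNIV :: ('x1 \<times> 'x2 \<times> 'y \<times> 'f1 \<times> 'f2) set)"
  have A: "finite A" "set_pmf P \<subseteq> A"
  proof -
    show "finite A" by (simp add: A_def)
    show "set_pmf P \<subseteq> A"
    proof
      fix a assume "a \<in> set_pmf P"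
      then have "pmf P a \<noteq> 0" by (simp add: set_pmf_iff)
      then have "fst a < L" by (cases a) (auto simp: pmf_P pmf_Q split: if_splits)
      then show "a \<in> A" by (cases a) (simp add: A_def)
    qed
  qed
  define \<pi> :: "nat \<times> 'x1 \<times> 'x2 \<times> 'y \<times> 'f1 \<times> 'f2 \<Rightarrow> ('x1 \<times> 'x2) \<times> 'y \<times> 'f1 \<times> 'f2"
    where "\<pi> = (\<lambda>(t, x1, x2, z). ((x1, x2), z))"
  \<comment> \<open>Fixing T yields the slices, for the informations given T; forgetting T in
    \<open>marg2\<close> adds them up, for I(X1, X2; Y).\<close>
  have marg1: "marg A (pmf P) (\<lambda>a. (\<pi> a, fst a)) (v, t) = joint (q t) id v" if "t < L" for v t
  proof -
    have "{a \<in> A. (\<pi> a, fst a) = (v, t)} = {(t, fst (fst v), snd (fst v), snd v)}"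
      using that by (cases v) (auto simp: A_def \<pi>_def)
    then show ?thesis using that by (cases v) (simp add: marg_def pmf_P pmf_Q joint_def)
  qed
  have marg2: "marg A (pmf P) \<pi> v = joint (\<lambda>v. \<Sum>t<L. q t v) id v" for v
  proof -
    have "{a \<in> A. \<pi> a = v} = (\<lambda>t. (t, fst (fst v), snd (fst v), snd v)) ` {..<L}"
      by (cases v) (auto simp: A_def \<pi>_def)
    then have "marg A (pmf P) \<pi> v = (\<Sum>t<L. pmf P (t, fst (fst v), snd (fst v), snd v))"
      by (simp add: marg_def sum.reindex inj_on_def)
    also have "\<dots> = (\<Sum>t<L. q t (fst v) * chan (fst v) (snd v))"
      by (intro sum.cong) (auto simp: pmf_P pmf_Q)
    finally show ?thesis by (simp add: joint_def case_prod_unfold sum_distrib_right)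
  qed
  have ent1: "ent A (pmf P) (\<lambda>a. (f (\<pi> a), fst a)) = (\<Sum>t<L. ent UNIV (joint (q t) id) f)"
    for f :: "_ \<Rightarrow> 'u"
  proof -
    have "ent A (pmf P) (\<lambda>a. (f (\<pi> a), fst a))
        = (\<Sum>t<L. ent UNIV (\<lambda>v. marg A (pmf P) (\<lambda>a. (\<pi> a, fst a)) (v, t)) f)"
      by (rule ent_slices) (auto simp: A_def)
    also have "\<dots> = (\<Sum>t<L. ent UNIV (joint (q t) id) f)"
      by (intro sum.cong refl ent_weight_cong) (simp add: marg1)
    finally show ?thesis .
  qed
  have ent2: "ent A (pmf P) (\<lambda>a. f (\<pi> a)) = ent UNIV (joint (\<lambda>v. \<Sum>t<L. q t v) id) f"
    for f :: "_ \<Rightarrow> 'u"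
    using A by (intro ent_image) (auto simp: marg2)
  let ?T = "\<lambda>(t, x1, x2, y, u1, u2). t" and ?X1 = "\<lambda>(t, x1, x2, y, u1, u2). x1"
    and ?X2 = "\<lambda>(t, x1, x2, y, u1, u2). x2" and ?Y = "\<lambda>(t, x1, x2, y, u1, u2). y"
    and ?F1 = "\<lambda>(t, x1, x2, y, u1, u2). u1" and ?F2 = "\<lambda>(t, x1, x2, y, u1, u2). u2"
  have mono: "x * ln b \<le> y \<Longrightarrow> x \<le> y / ln b" for x y
    using b by (simp add: pos_le_divide_eq)
  have 1: "ci A (pmf P) ?X1 (\<lambda>\<omega>. (?Y \<omega>, ?F2 \<omega>)) (\<lambda>\<omega>. (?X2 \<omega>, ?T \<omega>)) = (\<Sum>t<L. rate1 (q t))"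
    unfolding ci_def rate1_def sum.distrib sum_subtractf ent1[symmetric]
    by (intro arg_cong2[where f = "(+)"] arg_cong2[where f = "(-)"] ent_cong) (auto simp: \<pi>_def)
  have 2: "ci A (pmf P) ?X2 (\<lambda>\<omega>. (?Y \<omega>, ?F1 \<omega>)) (\<lambda>\<omega>. (?X1 \<omega>, ?T \<omega>)) = (\<Sum>t<L. rate2 (q t))"
    unfolding ci_def rate2_def sum.distrib sum_subtractf ent1[symmetric]
    by (intro arg_cong2[where f = "(+)"] arg_cong2[where f = "(-)"] ent_cong) (auto simp: \<pi>_def)
  have 3: "ci A (pmf P) (\<lambda>\<omega>. (?X1 \<omega>, ?X2 \<omega>)) (\<lambda>\<omega>. (?Y \<omega>, ?F1 \<omega>, ?F2 \<omega>)) ?T = (\<Sum>t<L. sum_rate (q t))"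
    unfolding ci_def sum_rate_def sum.distrib sum_subtractf ent1[symmetric]
    by (intro arg_cong2[where f = "(+)"] arg_cong2[where f = "(-)"] ent_cong) (auto simp: \<pi>_def)
  have 4: "ci A (pmf P) ?X1 ?X2 (\<lambda>\<omega>. (?F1 \<omega>, ?F2 \<omega>, ?T \<omega>)) - ci A (pmf P) ?X1 ?X2 ?T = (\<Sum>t<L. balance (q t))"
    unfolding ci_def balance_def sum.distrib sum_subtractf ent1[symmetric]
    by (intro arg_cong2[where f = "(+)"] arg_cong2[where f = "(-)"] ent_cong) (auto simp: \<pi>_def)
  have total: "(\<Sum>a\<in>A. pmf P a) = 1" using A by (rule sum_pmf_eq_1)
  \<comment> \<open>\<open>output_rate\<close> has a term for a constant and \<open>mi\<close> has
    none; it vanishes as \<open>P\<close> has mass 1.\<close>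
  have const: "ent A (pmf P) (\<lambda>_. ()) = 0"
    by (simp add: ent_def marg_def total)
  have "ent A (pmf P) (\<lambda>\<omega>. (?X1 \<omega>, ?X2 \<omega>)) + ent A (pmf P) ?Y - ent A (pmf P) (\<lambda>_. ())
      - ent A (pmf P) (\<lambda>\<omega>. ((?X1 \<omega>, ?X2 \<omega>), ?Y \<omega>)) = output_rate (\<lambda>v. \<Sum>t<L. q t v)"
    unfolding ci_def output_rate_def ent2[symmetric]
    by (intro arg_cong2[where f = "(+)"] arg_cong2[where f = "(-)"] ent_cong) (auto simp: \<pi>_def)
  then have 5: "ent A (pmf P) (\<lambda>\<omega>. (?X1 \<omega>, ?X2 \<omega>)) + ent A (pmf P) ?Y
      - ent A (pmf P) (\<lambda>\<omega>. ((?X1 \<omega>, ?X2 \<omega>), ?Y \<omega>)) = output_rate (\<lambda>v. \<Sum>t<L. q t v)"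
    using const by simp
  show ?thesis
    unfolding DB_region_def Let_def mem_Collect_eq prod.case
  proof (intro conjI R exI[of _ "{..<L}"] exI[of _ Q] exI[of _ P])
    show "card {..<L} \<le> CARD('x1) * CARD('x2) + 3" by (simp add: L_def)
    show "\<forall>\<omega>\<in>set_pmf P. ?T \<omega> \<in> {..<L}" using A(2) by (auto simp: A_def)
    show "\<forall>t x1 x2 y u1 u2. pmf P (t, x1, x2, y, u1, u2)
        = pmf Q (t, x1, x2) * pmf (V x1 x2) y * pmf (V1 x2) u1 * pmf (V2 x1) u2"
      by (simp add: pmf_P mult.assoc)
    show "cmi b P ?X1 ?X2 ?T \<le> cmi b P ?X1 ?X2 (\<lambda>\<omega>. (?F1 \<omega>, ?F2 \<omega>, ?T \<omega>))"
      using 4 F b unfolding cmi_eq_ci[OF b A] by (intro divide_right_mono) auto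
    show "R1 \<le> cmi b P ?X1 (\<lambda>\<omega>. (?Y \<omega>, ?F2 \<omega>)) (\<lambda>\<omega>. (?X2 \<omega>, ?T \<omega>))"
      unfolding cmi_eq_ci[OF b A] 1 using F by (intro mono) blast
    show "R2 \<le> cmi b P ?X2 (\<lambda>\<omega>. (?Y \<omega>, ?F1 \<omega>)) (\<lambda>\<omega>. (?X1 \<omega>, ?T \<omega>))"
      unfolding cmi_eq_ci[OF b A] 2 using F by (intro mono) blast
    show "R1 + R2 \<le> cmi b P (\<lambda>\<omega>. (?X1 \<omega>, ?X2 \<omega>)) (\<lambda>\<omega>. (?Y \<omega>, ?F1 \<omega>, ?F2 \<omega>)) ?T"
      unfolding cmi_eq_ci[OF b A] 3 using F by (intro mono) blast
    show "R1 + R2 \<le> mi b P (\<lambda>\<omega>. (?X1 \<omega>, ?X2 \<omega>)) ?Y"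
      unfolding mi_eq_ent[OF b A] 5 using F by (intro mono) blast
  qed simp
qed

lemma feasible_mono:
  assumes "r1' \<le> r1" "r2' \<le> r2" "r' \<le> r" "feasible q r1 r2 r"
  shows "feasible q r1' r2' r'"
  using assms(4) unfolding feasible_def
  by (elim conjE, intro conjI) (assumption | rule order_trans[OF assms(1)] order_trans[OF assms(2)] order_trans[OF assms(3)], assumption)+

lemma feasible_of_achievable:
  fixes W :: "('x1, 'x2, 'y, 'f1, 'f2) mac_gf"
  assumes b: "1 < b" and W: "\<And>x1 x2 z. pmf (W x1 x2) z = chan (x1, x2) z"
    and ach: "achievable b W R1 R2" and \<delta>: "0 < \<delta>"
  shows "\<exists>q. feasible q (R1 * ln b - \<delta>) (R2 * ln b - \<delta>) ((R1 + R2) * ln b - \<delta>)"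
proof -
  let ?r1 = "R1 * ln b" and ?r2 = "R2 * ln b"
  have lnb: "0 < ln b" using b by simp
  have R: "0 \<le> R1" "0 \<le> R2" using ach by (auto simp: achievable_def)
  have r: "0 \<le> ?r1" "0 \<le> ?r2" using R lnb by auto
  \<comment> \<open>Half of \<open>\<delta>\<close> pays for the Fano loss proportional to the rate,
    half for \<open>ln 2 / n\<close>. The \<open>1\<close> in the denominator covers zero rates, and
    the minimum keeps \<open>1 - \<epsilon>\<close> nonnegative.\<close>
  define \<epsilon> where "\<epsilon> = min 1 (\<delta> / (2 * (?r1 + ?r2 + 1)))"
  have \<epsilon>: "0 < \<epsilon>" "\<epsilon> \<le> 1" using \<delta> r by (auto simp: \<epsilon>_def)
  have "\<epsilon> * (?r1 + ?r2 + 1) \<le> \<delta> / (2 * (?r1 + ?r2 + 1)) * (?r1 + ?r2 + 1)"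
    using r by (intro mult_right_mono) (auto simp: \<epsilon>_def)
  also have "\<dots> = \<delta> / 2" using r by (simp add: field_simps)
  finally have \<epsilon>r: "\<epsilon> * (?r1 + ?r2 + 1) \<le> \<delta> / 2" .
  obtain N where N: "\<And>n. N \<le> n \<Longrightarrow> \<exists>M1 M2 Pe e1 e2 g. is_code W n M1 M2 Pe e1 e2 g \<and>
      R1 \<le> log b (real M1) / real n \<and> R2 \<le> log b (real M2) / real n \<and> Pe \<le> \<epsilon>"
    using ach \<epsilon>(1) unfolding achievable_def by blast
  obtain n0 :: nat where n0: "2 * ln 2 / \<delta> \<le> real n0" using real_arch_simple by blast
  define n where "n = Suc (max N n0)"
  have n: "0 < real n" "ln 2 / real n \<le> \<delta> / 2"
  proof -
    have "2 * ln 2 / \<delta> \<le> real n" using n0 by (simp add: n_def)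
    then show "ln 2 / real n \<le> \<delta> / 2" using \<delta> by (simp add: n_def field_simps)
  qed (simp add: n_def)
  obtain M1 M2 Pe e1 e2 g where code: "is_code W n M1 M2 Pe e1 e2 g"
    and rate: "R1 \<le> log b (real M1) / real n" "R2 \<le> log b (real M2) / real n" and "Pe \<le> \<epsilon>"
  proof -
    have "N \<le> n" by (simp add: n_def)
    from N[OF this] show ?thesis using that by blast
  qed
  then have err: "error_prob W n M1 M2 e1 e2 g \<le> \<epsilon>" by (simp add: is_code_def)
  interpret coded_mac V V1 V2 W M1 M2 e1 e2
    using code W by unfold_locales (auto simp: is_code_def)
  have lnM: "real n * ?r1 \<le> ln M1" "real n * ?r2 \<le> ln M2"
    using rate n(1) lnb by (auto simp: log_def field_simps)
  obtain I and q :: "nat \<times> ('f1 \<times> 'f2) list \<Rightarrow> 'x1 \<times> 'x2 \<Rightarrow> real"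
    where I: "finite I" and q: "\<And>t v. 0 \<le> q t v" and tot: "(\<Sum>t\<in>I. \<Sum>v\<in>UNIV. q t v) = n"
    and B: "(1 - \<epsilon>) * ln M1 - ln 2 \<le> (\<Sum>t\<in>I. rate1 (q t))"
    "(1 - \<epsilon>) * ln M2 - ln 2 \<le> (\<Sum>t\<in>I. rate2 (q t))"
    "(1 - \<epsilon>) * (ln M1 + ln M2) - ln 2 \<le> (\<Sum>t\<in>I. sum_rate (q t))"
    "0 \<le> (\<Sum>t\<in>I. balance (q t))"
    "(1 - \<epsilon>) * (ln M1 + ln M2) - ln 2 \<le> output_rate (\<lambda>v. \<Sum>t\<in>I. q t v)"
    by (rule code_family[OF err]) (rule that; assumption)
  have c: "0 \<le> 1 / real n" by simp
  \<comment> \<open>Common to all four rate bounds: \<open>m\<close> is \<open>ln M1\<close>,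
    \<open>ln M2\<close> or their sum, and \<open>r\<close> the corresponding rate.\<close>
  have rate: "r - \<delta> \<le> 1 / real n * s"
    if "(1 - \<epsilon>) * m - ln 2 \<le> s" "real n * r \<le> m" "0 \<le> r" "r \<le> ?r1 + ?r2" for r m s
  proof -
    have "\<epsilon> * r \<le> \<epsilon> * (?r1 + ?r2 + 1)" using that(4) \<epsilon>(1) by (intro mult_left_mono) auto
    then have "r - \<delta> \<le> (1 - \<epsilon>) * r - ln 2 / real n"
      using \<epsilon>r n(2) by (simp add: left_diff_distrib)
    also have "\<dots> = 1 / real n * ((1 - \<epsilon>) * (real n * r) - ln 2)"
      using n(1) by (simp add: field_simps)
    also have "\<dots> \<le> 1 / real n * s"
    proof (rule mult_left_mono)
      have "(1 - \<epsilon>) * (real n * r) \<le> (1 - \<epsilon>) * m" using that(2) \<epsilon>(2) by (intro mult_left_mono) auto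
      then show "(1 - \<epsilon>) * (real n * r) - ln 2 \<le> s" using that(1) by linarith
    qed simp
    finally show ?thesis .
  qed
  show ?thesis
  proof (rule feasible_of_family[OF I, of "\<lambda>t v. 1 / real n * q t v"])
    show "0 \<le> 1 / real n * q t v" for t v using q by simp
    show "(\<Sum>t\<in>I. \<Sum>v\<in>UNIV. 1 / real n * q t v) = 1"
      using tot n(1) unfolding sum_distrib_left[symmetric] by simp
    show "?r1 - \<delta> \<le> (\<Sum>t\<in>I. rate1 (\<lambda>v. 1 / real n * q t v))"
      unfolding functionals_scale(1)[OF c q] sum_distrib_left[symmetric] by (rule rate[OF B(1) lnM(1)]) (use r in auto)
    show "?r2 - \<delta> \<le> (\<Sum>t\<in>I. rate2 (\<lambda>v. 1 / real n * q t v))"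
      unfolding functionals_scale(2)[OF c q] sum_distrib_left[symmetric] by (rule rate[OF B(2) lnM(2)]) (use r in auto)
    show "(R1 + R2) * ln b - \<delta> \<le> (\<Sum>t\<in>I. sum_rate (\<lambda>v. 1 / real n * q t v))"
      unfolding functionals_scale(3)[OF c q] sum_distrib_left[symmetric]
      by (rule rate[OF B(3)]) (use r lnM in \<open>auto simp: distrib_left distrib_right\<close>)
    show "0 \<le> (\<Sum>t\<in>I. balance (\<lambda>v. 1 / real n * q t v))"
      unfolding functionals_scale(4)[OF c q] sum_distrib_left[symmetric] using B(4) by simp
    have "output_rate (\<lambda>v. \<Sum>t\<in>I. 1 / real n * q t v) = 1 / real n * output_rate (\<lambda>v. \<Sum>t\<in>I. q t v)"
      unfolding sum_distrib_left[symmetric] using q by (intro functionals_scale(5)[OF c]) (simp add: sum_nonneg)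
    then show "(R1 + R2) * ln b - \<delta> \<le> output_rate (\<lambda>v. \<Sum>t\<in>I. 1 / real n * q t v)"
      using rate[OF B(5), of "(R1 + R2) * ln b"] r lnM by (simp add: distrib_left distrib_right)
  qed
qed

end

theorem theorem4:
  fixes b :: real
    and W :: "('x1::finite, 'x2::finite, 'y::finite, 'f1::finite, 'f2::finite) mac_gf"
    and V :: "'x1 \<Rightarrow> 'x2 \<Rightarrow> 'y pmf"
    and V1 :: "'x2 \<Rightarrow> 'f1 pmf"
    and V2 :: "'x1 \<Rightarrow> 'f2 pmf"
  assumes "1 < b"
    and "\<And>x1 x2 y u1 u2.
      pmf (W x1 x2) (y, u1, u2) = pmf (V x1 x2) y * pmf (V1 x2) u1 * pmf (V2 x1) u2"
  shows "capacity_region b W \<subseteq> DB_region b V V1 V2"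
proof
  interpret separable_mac V V1 V2 .
  have W: "pmf (W x1 x2) z = chan (x1, x2) z" for x1 x2 z
    by (cases z) (simp add: assms(2))
  have lnb: "0 < ln b" using assms(1) by simp
  fix R assume "R \<in> capacity_region b W"
  moreover obtain R1 R2 where R: "R = (R1, R2)" by (cases R)
  ultimately have cl: "(R1, R2) \<in> closure {(R1, R2). achievable b W R1 R2}"
    by (simp add: capacity_region_def)
  have near: "\<exists>a1 a2. achievable b W a1 a2 \<and> \<bar>R1 - a1\<bar> < e \<and> \<bar>R2 - a2\<bar> < e" if "0 < e" for e
  proof -
    obtain a where "a \<in> {(R1, R2). achievable b W R1 R2}" "dist a (R1, R2) < e"
      using cl \<open>0 < e\<close> unfolding closure_approachable by blast
    then show ?thesis
      using dist_fst_le[of a "(R1, R2)"] dist_snd_le[of a "(R1, R2)"]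
      by (intro exI[of _ "fst a"] exI[of _ "snd a"]) (auto simp: dist_real_def)
  qed
  have "0 \<le> R1" "0 \<le> R2"
  proof -
    have "0 \<le> R1 + e \<and> 0 \<le> R2 + e" if e: "0 < e" for e
    proof -
      obtain a1 a2 where "0 \<le> a1" "0 \<le> a2" "\<bar>R1 - a1\<bar> < e" "\<bar>R2 - a2\<bar> < e"
        using near[OF e] unfolding achievable_def by blast
      then show ?thesis by linarith
    qed
    then show "0 \<le> R1" "0 \<le> R2" by (auto intro: field_le_epsilon)
  qed
  moreover have "\<exists>q. feasible q (R1 * ln b) (R2 * ln b) ((R1 + R2) * ln b)"
  proof (rule feasible_closed)
    fix \<delta> :: real assume \<delta>: "0 < \<delta>"
    \<comment> \<open>A quarter of \<open>\<delta>\<close> for approximating each rate; in the sum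
      the two quarters join the \<open>\<delta> / 2\<close> given to
      \<open>feasible_of_achievable\<close>.\<close>
    define e where "e = \<delta> / (4 * ln b)"
    have e: "0 < e" "e * ln b = \<delta> / 4" using \<delta> lnb by (auto simp: e_def)
    obtain a1 a2 where a: "achievable b W a1 a2" "\<bar>R1 - a1\<bar> < e" "\<bar>R2 - a2\<bar> < e"
      using near[OF e(1)] by blast
    obtain q where q: "feasible q (a1 * ln b - \<delta> / 2) (a2 * ln b - \<delta> / 2) ((a1 + a2) * ln b - \<delta> / 2)"
      using feasible_of_achievable[OF assms(1) W a(1), of "\<delta> / 2"] \<delta> by auto
    have "R1 * ln b \<le> (a1 + e) * ln b" "R2 * ln b \<le> (a2 + e) * ln b"
      using a lnb by (auto intro!: mult_right_mono)
    then have "R1 * ln b \<le> a1 * ln b + \<delta> / 4" "R2 * ln b \<le> a2 * ln b + \<delta> / 4"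
      using e(2) by (simp_all add: distrib_right)
    then have "R1 * ln b - \<delta> \<le> a1 * ln b - \<delta> / 2" "R2 * ln b - \<delta> \<le> a2 * ln b - \<delta> / 2"
        "(R1 + R2) * ln b - \<delta> \<le> (a1 + a2) * ln b - \<delta> / 2"
      using \<delta> by (simp_all add: distrib_right)
    then have "feasible q (R1 * ln b - \<delta>) (R2 * ln b - \<delta>) ((R1 + R2) * ln b - \<delta>)"
      using q by (rule feasible_mono)
    then show "\<exists>q. feasible q (R1 * ln b - \<delta>) (R2 * ln b - \<delta>) ((R1 + R2) * ln b - \<delta>)" by blast
  qed
  ultimately show "R \<in> DB_region b V V1 V2"
    unfolding R using DB_region_of_feasible[OF assms(1) W] by blast
qed

end
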